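(* Let $n\ge 2$ and let $1<a_1<a_2<\dots<a_n$ be integers such that there are infinitely many primes $p$ for which every one of $a_1,\dots,a_n$ is a primitive root of $p$. Then there exists a Liouville number which is normal to the base $a_i$ for every $1\le i\le n$.
   Context: An integer $a$ is a primitive root of a prime $p$ if $a$ is coprime to $p$ and $a, a^2,\dots,a^{p-1}$ are pairwise distinct modulo $p$ (i.e. $a$ generates the multiplicative group modulo $p$). A real number $\alpha$ in the unit interval is a Liouville number if for every positive integer $N$ there are integers $p>0$ and $q>1$ such that $0<\left|\alpha-\frac{p}{q}\right|<\frac{1}{q^N}$. For an integer base $b\ge 2$, a real number in the unit interval with base-$b$ expansion $0.x_0x_1x_2\dots$ is normal to the base $b$ if for every $m\ge 1$ and every string $w\in\{0,\dots,b-1\}^m$, the number of indices $i$ with $0\le i\le j-m$ and $x_i\cdots x_{i+m-1}=w$, divided by $j$, tends to $b^{-m}$ as $j\to\infty$. *)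

theory Defs
  imports "HOL-Analysis.Analysis" "HOL-Number_Theory.Number_Theory"
begin

text \<open>
  ``\<open>a\<close> is a primitive root of the prime \<open>p\<close>'' is the library predicate
  \<open>residue_primroot p a\<close>, whose definition is via the multiplicative order.  For prime
  moduli it agrees with the definition by distinctness of the first \<open>p - 1\<close> powers:
\<close>

lemma residue_primroot_prime_iff_powers_distinct:
  fixes p a :: nat
  assumes "prime p"
  shows "residue_primroot p a \<longleftrightarrow> coprime a p \<and> inj_on (\<lambda>k. a ^ k mod p) {1..p - 1}"
proof (cases "coprime p a")
  case True
  have p: "p > 1"
    using assms prime_gt_1_nat by blast
  have pow_eq: "a ^ k mod p = a ^ l mod p \<longleftrightarrow> [k = l] (mod ord p a)" for k l
    using order_divides_expdiff[OF True, of k l] by (simp add: cong_def)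
  have dvd: "ord p a dvd p - 1"
    using order_divides_totient[OF True] totient_prime[OF assms] by simp
  have pos: "ord p a > 0"
    using True by (simp add: ord_eq_0)
  have "inj_on (\<lambda>k. a ^ k mod p) {1..p - 1} \<longleftrightarrow> ord p a = p - 1"
  proof
    assume inj: "inj_on (\<lambda>k. a ^ k mod p) {1..p - 1}"
    show "ord p a = p - 1"
    proof (rule inj_onD[OF inj])
      show "a ^ ord p a mod p = a ^ (p - 1) mod p"
        unfolding pow_eq using dvd by (simp add: cong_def)
      show "ord p a \<in> {1..p - 1}"
        using pos dvd p by (auto intro: dvd_imp_le)
    qed (use p in auto)
  next
    assume ord: "ord p a = p - 1"
    show "inj_on (\<lambda>k. a ^ k mod p) {1..p - 1}"
    proof (rule inj_onI)
      fix k l assume kl: "k \<in> {1..p - 1}" "l \<in> {1..p - 1}"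
        and "a ^ k mod p = a ^ l mod p"
      then have c: "[k = l] (mod (p - 1))"
        unfolding pow_eq ord by simp
      show "k = l"
      proof (cases "k = p - 1 \<or> l = p - 1")
        case True
        with c have "p - 1 dvd k" "p - 1 dvd l"
          by (auto simp: cong_def mod_eq_0_iff_dvd)
        with kl show ?thesis
          by (auto dest!: dvd_imp_le)
      next
        case False
        with kl have "k < p - 1" "l < p - 1" by auto
        with c show ?thesis by (simp add: cong_def)
      qed
    qed
  qed
  then show ?thesis
    using True p totient_prime[OF assms] by (simp add: residue_primroot_def coprime_commute)
next
  case False
  then show ?thesis by (simp add: residue_primroot_def coprime_commute)
qed

definition liouville_number :: "real \<Rightarrow> bool" where
  "liouville_number \<alpha> \<longleftrightarrow> \<alpha> \<in> {0..1} \<and>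
     (\<forall>N::nat. N > 0 \<longrightarrow> (\<exists>p q :: int. p > 0 \<and> q > 1 \<and>
        0 < \<bar>\<alpha> - of_int p / of_int q\<bar> \<and> \<bar>\<alpha> - of_int p / of_int q\<bar> < 1 / of_int q ^ N))"

text \<open>
  Position \<open>0\<close> is the first digit after the radix point.  For a number with two expansions
  this picks the terminating one, which does not affect normality: neither of them is normal.
\<close>

definition base_digit :: "nat \<Rightarrow> real \<Rightarrow> nat \<Rightarrow> nat" where
  "base_digit b \<alpha> i = nat (\<lfloor>\<alpha> * real b ^ Suc i\<rfloor> mod int b)"

lemma base_digit_less: "b > 0 \<Longrightarrow> base_digit b \<alpha> i < b"
  by (simp add: base_digit_def nat_less_iff)

lemma base_digit_sums:
  assumes b: "b \<ge> 2" and \<alpha>: "\<alpha> \<in> {0..<1}"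
  shows "(\<lambda>i. real (base_digit b \<alpha> i) / real b ^ Suc i) sums \<alpha>"
proof -
  have digit: "real (base_digit b \<alpha> i) =
      of_int \<lfloor>\<alpha> * real b ^ Suc i\<rfloor> - real b * of_int \<lfloor>\<alpha> * real b ^ i\<rfloor>" for i
  proof -
    have "\<lfloor>\<alpha> * real b ^ Suc i\<rfloor> div int b = \<lfloor>\<alpha> * real b ^ Suc i / of_int (int b)\<rfloor>"
      by (rule floor_divide_real_eq_div [symmetric]) simp
    also have "\<alpha> * real b ^ Suc i / of_int (int b) = \<alpha> * real b ^ i"
      using b by simp
    finally have div: "\<lfloor>\<alpha> * real b ^ Suc i\<rfloor> div int b = \<lfloor>\<alpha> * real b ^ i\<rfloor>" .
    have "int (base_digit b \<alpha> i) = \<lfloor>\<alpha> * real b ^ Suc i\<rfloor> mod int b"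
      unfolding base_digit_def using b by (intro int_nat_eq[THEN trans]) auto
    also have "\<dots> = \<lfloor>\<alpha> * real b ^ Suc i\<rfloor> - int b * \<lfloor>\<alpha> * real b ^ i\<rfloor>"
      unfolding div [symmetric] by (rule minus_mult_div_eq_mod [symmetric])
    finally have "int (base_digit b \<alpha> i) =
        \<lfloor>\<alpha> * real b ^ Suc i\<rfloor> - int b * \<lfloor>\<alpha> * real b ^ i\<rfloor>" .
    then have "real_of_int (int (base_digit b \<alpha> i)) =
        real_of_int (\<lfloor>\<alpha> * real b ^ Suc i\<rfloor> - int b * \<lfloor>\<alpha> * real b ^ i\<rfloor>)"
      by (rule arg_cong)
    then show ?thesis by simp
  qed
  have partial: "(\<Sum>i<n. real (base_digit b \<alpha> i) / real b ^ Suc i) =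
      of_int \<lfloor>\<alpha> * real b ^ n\<rfloor> / real b ^ n" for n
  proof (induction n)
    case 0
    have "\<lfloor>\<alpha>\<rfloor> = 0" using \<alpha> by (simp add: floor_eq_iff)
    then show ?case by simp
  next
    case (Suc n)
    then show ?case using b by (simp add: digit divide_simps)
  qed
  have bound: "\<bar>of_int \<lfloor>\<alpha> * real b ^ n\<rfloor> / real b ^ n - \<alpha>\<bar> \<le> (1 / real b) ^ n" for n
  proof -
    have "of_int \<lfloor>\<alpha> * real b ^ n\<rfloor> / real b ^ n - \<alpha> =
        (of_int \<lfloor>\<alpha> * real b ^ n\<rfloor> - \<alpha> * real b ^ n) / real b ^ n"
      using b by (simp add: diff_divide_distrib)
    also have "\<bar>\<dots>\<bar> \<le> 1 / real b ^ n"
      unfolding abs_divide using b by (intro frac_le) (auto, linarith)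
    finally show ?thesis by (simp add: power_one_over)
  qed
  have "(\<lambda>n. (1 / real b) ^ n) \<longlonglongrightarrow> 0"
    using b by (intro LIMSEQ_power_zero) simp
  then have "(\<lambda>n. of_int \<lfloor>\<alpha> * real b ^ n\<rfloor> / real b ^ n - \<alpha>) \<longlonglongrightarrow> 0"
    by (rule Lim_null_comparison[rotated]) (use bound in simp)
  then show ?thesis
    unfolding sums_def partial using LIM_zero_iff by blast
qed

text \<open>The condition \<open>i + length w \<le> j\<close> is \<open>i \<le> j - m\<close> without truncated subtraction.\<close>

definition occurrences :: "nat \<Rightarrow> real \<Rightarrow> nat list \<Rightarrow> nat \<Rightarrow> nat set" where
  "occurrences b \<alpha> w j =
     {i. i + length w \<le> j \<and> (\<forall>k<length w. base_digit b \<alpha> (i + k) = w ! k)}"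

text \<open>The point \<open>1\<close> of the unit interval has only the expansion with all digits \<open>b - 1\<close>,
  hence is not normal.\<close>

definition normal_to_base :: "nat \<Rightarrow> real \<Rightarrow> bool" where
  "normal_to_base b \<alpha> \<longleftrightarrow> b \<ge> 2 \<and> \<alpha> \<in> {0..<1} \<and>
     (\<forall>m\<ge>1. \<forall>w. length w = m \<and> set w \<subseteq> {..<b} \<longrightarrow>
        (\<lambda>j. real (card (occurrences b \<alpha> w j)) / real j) \<longlonglongrightarrow> 1 / real b ^ m)"

end

theory Submission
  imports Defs "HOL-Real_Asymp.Real_Asymp"
begin

text \<open>
  The number is the limit of fractions \<open>x\<^sub>k = c\<^sub>k / p\<^sub>k\<close> with \<open>p\<^sub>k\<close> one of the given primes, where
  \<open>x\<^sub>k\<^sub>+\<^sub>1\<close> is taken in an interval to the right of \<open>x\<^sub>k\<close> shorter than \<open>1 / p\<^sub>k ^ k\<close>.  Normality is checked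
  with Weyl sums \<open>\<Sum>j<J. exp (2 \<pi> i h b ^ j x)\<close>.  If \<open>b\<close> is a primitive root of \<open>p\<close>, the Weyl sum of
  \<open>c / p\<close> over a full period is \<open>-1\<close>, so only \<open>J < p\<close> matters.

  The issue is that \<open>x\<^sub>k\<^sub>+\<^sub>1\<close> must have small Weyl sums immediately after the position \<open>L\<close> (about
  \<open>log\<^sub>b (1 / \<delta>)\<close>) where its expansion departs from that of \<open>x\<^sub>k\<close>, with bounds independent of the length
  \<open>\<delta>\<close> of the interval.  This follows from a second moment over all admissible numerators \<open>c\<close>, about
  \<open>p \<delta>\<close> many.  For windows \<open>[L, L + J)\<close> with \<open>b ^ (L + J)\<close> much smaller than \<open>p\<close>, the off-diagonal terms are
  geometric sums and the moment is \<open>O(p \<delta> J)\<close>.  For all other \<open>J < p\<close>, enlarging the range of \<open>c\<close> to all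
  residues gives at most \<open>p J\<close> by orthogonality; such \<open>J\<close> are so large, once \<open>p\<close> is large in terms of
  \<open>\<delta>\<close>, that losing the factor \<open>1 / \<delta>\<close> is harmless.  Summing over the cubes \<open>J = t ^ 3\<close> with weights
  \<open>t ^ (-5)\<close> yields one numerator that is good for all \<open>J\<close> at once.
\<close>

section \<open>Exponential sums and their second moments\<close>

definition ee :: "real \<Rightarrow> complex" where
  "ee x = cis (2 * pi * x)"

lemma ee_add: "ee (x + y) = ee x * ee y"
  by (simp add: ee_def cis_mult algebra_simps)

lemma cnj_ee: "cnj (ee x) = ee (- x)"
  by (simp add: ee_def cis_cnj)

lemma norm_ee [simp]: "norm (ee x) = 1"
  by (simp add: ee_def)

lemma ee_int [simp]: "x \<in> \<int> \<Longrightarrow> ee x = 1"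
  by (simp add: ee_def)

lemma ee_power: "ee (real n * x) = ee x ^ n"
  unfolding ee_def Complex.DeMoivre by (rule arg_cong[of _ _ cis]) simp

lemma ee_cong:
  assumes "x - y \<in> \<int>"
  shows "ee x = ee y"
  using ee_add[of "x - y" y] assms by simp

lemma norm_ee_minus_1: "norm (ee x - 1) = 2 * \<bar>sin (pi * x)\<bar>"
  using dist_exp_i_1[of "2 * pi * x"] by (simp add: ee_def cis_conv_exp)

lemma norm_ee_diff_le: "norm (ee x - ee y) \<le> 2 * pi * \<bar>x - y\<bar>"
proof -
  have "ee x - ee y = ee y * (ee (x - y) - 1)"
    by (simp add: algebra_simps flip: ee_add)
  then have "norm (ee x - ee y) = 2 * \<bar>sin (pi * (x - y))\<bar>"
    by (simp add: norm_mult norm_ee_minus_1)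
  also have "\<dots> \<le> 2 * \<bar>pi * (x - y)\<bar>"
    using abs_sin_x_le_abs_x by (intro mult_left_mono) auto
  finally show ?thesis by (simp add: abs_mult)
qed

text \<open>The mean value theorem gives sin (pi y) = pi y cos z with 0 < z < pi / 3; there cos z is
  at least 1 / 2, and pi / 2 exceeds 1.\<close>

lemma norm_ee_minus_1_ge:
  assumes "\<bar>x\<bar> \<le> 1 / 3"
  shows "2 * \<bar>x\<bar> \<le> norm (ee x - 1)"
proof -
  have *: "y \<le> sin (pi * y)" if y: "0 < y" "y \<le> 1 / 3" for y :: real
  proof -
    obtain z where z: "0 < z" "z < pi * y" "sin (pi * y) - sin 0 = (pi * y - 0) * cos z"
      using MVT2[of 0 "pi * y" sin cos] y by (auto intro: DERIV_sin)
    have "cos (pi / 3) \<le> cos z"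
      using z(1,2) y pi_gt_zero mult_left_mono[OF y(2), of pi]
      by (intro cos_monotone_0_pi_le) linarith+
    then have "1 / 2 \<le> cos z" by (simp add: cos_60)
    then have "pi * y * (1 / 2) \<le> pi * y * cos z"
      using y by (intro mult_left_mono) auto
    moreover have "1 * y \<le> (pi / 2) * y"
      using y pi_gt3 by (intro mult_right_mono) auto
    moreover have "sin (pi * y) = pi * y * cos z" using z(3) by simp
    ultimately show ?thesis by linarith
  qed
  have "\<bar>x\<bar> \<le> \<bar>sin (pi * x)\<bar>"
  proof (cases "x = 0")
    case False
    then have "\<bar>x\<bar> \<le> sin (pi * \<bar>x\<bar>)" using assms by (intro *) auto
    also have "\<dots> \<le> \<bar>sin (pi * x)\<bar>" by (cases "x \<ge> 0") auto
    finally show ?thesis .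
  qed simp
  then show ?thesis by (simp add: norm_ee_minus_1)
qed

text \<open>Multiplication by \<open>ee \<theta> - 1\<close> telescopes the sum to a difference of
  two unit numbers, and that factor has norm at least \<open>2 * \<bar>\<theta>\<bar>\<close>. The
  bound does not depend on the range of summation.\<close>

lemma norm_geometric_sum_le:
  assumes "\<theta> \<noteq> 0" "\<bar>\<theta>\<bar> \<le> 1 / 3"
  shows "norm (\<Sum>c\<in>{A..<B::nat}. ee (\<theta> * real c)) \<le> 1 / \<bar>\<theta>\<bar>"
proof (cases "A \<le> B")
  case True
  let ?S = "\<Sum>c\<in>{A..<B}. ee (\<theta> * real c)"
  have "(ee \<theta> - 1) * ?S = (\<Sum>c\<in>{A..<B}. ee (\<theta> * real (Suc c)) - ee (\<theta> * real c))"
    by (simp add: sum_distrib_left algebra_simps ee_add)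
  also have "\<dots> = ee (\<theta> * real B) - ee (\<theta> * real A)"
    using sum_Suc_diff'[OF True, of "\<lambda>c. ee (\<theta> * real c)"] .
  finally have eq: "(ee \<theta> - 1) * ?S = ee (\<theta> * real B) - ee (\<theta> * real A)" .
  have "norm (ee \<theta> - 1) * norm ?S \<le> 2"
    unfolding norm_mult[symmetric] eq
    using norm_triangle_ineq4[of "ee (\<theta> * real B)" "ee (\<theta> * real A)"] by simp
  moreover have "2 * \<bar>\<theta>\<bar> * norm ?S \<le> norm (ee \<theta> - 1) * norm ?S"
    using norm_ee_minus_1_ge[OF assms(2)] by (intro mult_right_mono) auto
  ultimately show ?thesis using assms by (simp add: field_simps)
qed simp

text \<open>Orthogonality of additive characters modulo \<open>p\<close>: the ratio of the geometric
  progression is a \<open>p\<close>-th root of unity other than 1.\<close>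

lemma sum_ee_multiples_prime:
  fixes p :: nat and r :: int
  assumes "p > 0" "\<not> int p dvd r"
  shows "(\<Sum>c<p. ee (real_of_int r / real p * real c)) = 0"
proof -
  let ?z = "ee (real_of_int r / real p)"
  have "?z \<noteq> 1"
  proof
    assume "?z = 1"
    then have "cos (2 * pi * (real_of_int r / real p)) = 1"
      by (metis ee_def cis.sel(1) one_complex.sel(1))
    then obtain k :: int where "2 * pi * (real_of_int r / real p) = real_of_int k * 2 * pi"
      using cos_one_2pi_int by blast
    then have "real_of_int r = real_of_int (k * int p)"
      using assms(1) by (simp add: field_simps)
    then have "r = k * int p" by linarith
    with assms(2) show False by simp
  qed
  moreover have "?z ^ p = 1"
    using assms(1) by (simp flip: ee_power)
  ultimately have "(\<Sum>c<p. ?z ^ c) = 0"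
    by (simp add: sum_gp_strict)
  then show ?thesis by (simp flip: ee_power add: mult.commute)
qed

section \<open>Second moments over ranges of numerators\<close>

text \<open>Each square is the sum times its conjugate. Exchanging the sums moves the one over the
  numerators \<open>c\<close> inside, where cancellation can be exploited.\<close>

lemma second_moment_le:
  fixes g :: "nat \<Rightarrow> real" and I :: "nat set"
  shows "(\<Sum>c\<in>I. (norm (\<Sum>j<J. ee (g j * real c)))\<^sup>2)
    \<le> (\<Sum>j<J. \<Sum>k<J. norm (\<Sum>c\<in>I. ee ((g j - g k) * real c)))"
proof -
  have "complex_of_real (\<Sum>c\<in>I. (norm (\<Sum>j<J. ee (g j * real c)))\<^sup>2)
      = (\<Sum>c\<in>I. (\<Sum>j<J. ee (g j * real c)) * (\<Sum>k<J. ee (- (g k * real c))))"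
    by (simp add: complex_norm_square cnj_ee flip: of_real_power)
  also have "\<dots> = (\<Sum>c\<in>I. \<Sum>j<J. \<Sum>k<J. ee ((g j - g k) * real c))"
    by (simp add: sum_product algebra_simps flip: ee_add)
  also have "\<dots> = (\<Sum>j<J. \<Sum>k<J. \<Sum>c\<in>I. ee ((g j - g k) * real c))"
    by (subst sum.swap, rule sum.cong[OF refl], rule sum.swap)
  finally have eq: "complex_of_real (\<Sum>c\<in>I. (norm (\<Sum>j<J. ee (g j * real c)))\<^sup>2)
      = (\<Sum>j<J. \<Sum>k<J. \<Sum>c\<in>I. ee ((g j - g k) * real c))" .
  have "(\<Sum>c\<in>I. (norm (\<Sum>j<J. ee (g j * real c)))\<^sup>2)
      = norm (complex_of_real (\<Sum>c\<in>I. (norm (\<Sum>j<J. ee (g j * real c)))\<^sup>2))"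
    unfolding norm_of_real by (intro abs_of_nonneg[symmetric] sum_nonneg) auto
  also have "\<dots> \<le> (\<Sum>j<J. norm (\<Sum>k<J. \<Sum>c\<in>I. ee ((g j - g k) * real c)))"
    unfolding eq by (rule norm_sum)
  also have "\<dots> \<le> (\<Sum>j<J. \<Sum>k<J. norm (\<Sum>c\<in>I. ee ((g j - g k) * real c)))"
    by (intro sum_mono norm_sum)
  finally show ?thesis .
qed

lemma sum_half_powers_le: "(\<Sum>k\<in>A. (1 / 2 :: real) ^ k) \<le> 2" if "finite A"
proof -
  have "(\<Sum>k\<in>A. (1 / 2 :: real) ^ k) \<le> (\<Sum>k. (1 / 2 :: real) ^ k)"
    using that by (intro sum_le_suminf) auto
  also have "\<dots> = 2" by (subst suminf_geometric) auto
  finally show ?thesis .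
qed

text \<open>All frequencies are below 1 / 3 in this window, so no wrap-around modulo 1 occurs and
  the off-diagonal sums are genuine geometric sums. The diagonal contributes 2 and the rest 8 to the
  constant 10.\<close>

lemma second_moment_short_window:
  fixes b h p L J A B :: nat
  assumes b: "b \<ge> 2" and h: "h \<ge> 1" and p: "p > 0"
    and \<delta>: "real b ^ L * \<delta> \<ge> 1"
    and card: "real (B - A) \<le> 2 * (real p * \<delta>)"
    and short: "3 * h * b ^ (L + J) \<le> p"
  shows "(\<Sum>c\<in>{A..<B}. (norm (\<Sum>j<J. ee (real h * real b ^ (L + j) / real p * real c)))\<^sup>2)
    \<le> 10 * (real p * \<delta>) * real J"
proof -
  define g where "g = (\<lambda>j. real h * real b ^ (L + j) / real p)"
  have \<delta>0: "\<delta> > 0"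
    using \<delta> b by (metis less_le_not_le linorder_not_less mult_nonneg_nonpos of_nat_0_le_iff
        order_trans zero_le_power zero_less_one)
  have off: "norm (\<Sum>c\<in>{A..<B}. ee ((g j - g k) * real c)) \<le> 2 * (real p * \<delta>) * (1 / 2) ^ max j k"
    if jk: "j < J" "k < J" "j \<noteq> k" for j k
  proof -
    \<comment> \<open>The frequencies at least double at each index, so the larger one,
      \<open>g m\<close>, controls the difference. \<open>short\<close> keeps it within the range of
      the geometric sum bound, and the hypothesis on \<open>L\<close> turns its reciprocal into a
      multiple of \<open>real p * \<delta>\<close> that decays with \<open>m\<close>.\<close>
    have gen: "g m * (1 / 2) \<le> g m - g l \<and> g m - g l \<le> 1 / 3 \<and> (1 / g m) \<le> real p * \<delta> * (1 / 2) ^ m"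
      if ml: "l < m" "m < J" for m l
    proof (intro conjI)
      have "real b ^ (L + l) * 2 \<le> real b ^ (L + l) * real b"
        using b by (intro mult_left_mono) auto
      also have "\<dots> = real b ^ Suc (L + l)" by simp
      also have "\<dots> \<le> real b ^ (L + m)"
        using b ml by (intro power_increasing) auto
      finally have "g l * 2 \<le> g m"
        unfolding g_def using mult_left_mono[of "real b ^ (L + l) * 2" "real b ^ (L + m)" "real h / real p"]
        by (simp add: mult_ac)
      then show "g m * (1 / 2) \<le> g m - g l" by simp
      have "b ^ (L + m) \<le> b ^ (L + J)" using ml b by (intro power_increasing) auto
      then have "3 * h * b ^ (L + m) \<le> p" using short by (meson le_trans mult_le_mono2)
      then have "3 * real h * real b ^ (L + m) \<le> real p"
        by (metis of_nat_le_iff of_nat_mult of_nat_numeral of_nat_power)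
      then have "g m \<le> 1 / 3" using p by (simp add: g_def field_simps)
      moreover have "g l \<ge> 0" by (simp add: g_def)
      ultimately show "g m - g l \<le> 1 / 3" by simp
      have "1 / g m = real p / (real h * (real b ^ L * real b ^ m))"
        by (simp add: g_def power_add)
      also have "\<dots> \<le> real p / (1 * (1 / \<delta> * 2 ^ m))"
        using b h p \<delta> \<delta>0
        by (intro divide_left_mono mult_mono power_mono mult_pos_pos) (auto simp: field_simps)
      also have "\<dots> = real p * \<delta> * (1 / 2) ^ m"
        by (simp add: power_one_over field_simps)
      finally show "1 / g m \<le> real p * \<delta> * (1 / 2) ^ m" .
    qed
    have gpos: "g m > 0" for m using b h p by (simp add: g_def)
    define m where "m = max j k"
    define l where "l = min j k"
    have ml: "l < m" "m < J" using jk by (auto simp: m_def l_def)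
    have abs: "\<bar>g j - g k\<bar> = g m - g l"
      using gen[of j k] gen[of k j] gpos[of j] gpos[of k] jk
      by (cases "j < k") (auto simp: m_def l_def max_def min_def)
    have pos: "g m - g l > 0" using gen[OF ml] gpos[of m] by auto
    have "norm (\<Sum>c\<in>{A..<B}. ee ((g j - g k) * real c)) \<le> 1 / \<bar>g j - g k\<bar>"
      using abs gen[OF ml] pos by (intro norm_geometric_sum_le) auto
    also have "\<dots> \<le> 1 / (g m * (1 / 2))"
      unfolding abs using gen[OF ml] gpos[of m] pos by (intro divide_left_mono) auto
    also have "\<dots> = 2 * (1 / g m)" by simp
    also have "\<dots> \<le> 2 * (real p * \<delta> * (1 / 2) ^ m)"
      using gen[OF ml] by (intro mult_left_mono) auto
    finally show ?thesis by (simp add: m_def)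
  qed
  \<comment> \<open>Replacing the power at the maximum by a sum of two powers separates the double
    sum: one index gives a convergent series, the other the factor \<open>J\<close>.\<close>
  have ub: "norm (\<Sum>c\<in>{A..<B}. ee ((g j - g k) * real c))
      \<le> (if j = k then 2 * (real p * \<delta>) else 0)
        + 2 * (real p * \<delta>) * ((1 / 2) ^ j + (1 / 2) ^ k)"
    if jk: "j < J" "k < J" for j k
  proof (cases "j = k")
    case True
    then show ?thesis using card \<delta>0 by (auto intro: add_increasing2)
  next
    case False
    have "(1 / 2 :: real) ^ max j k \<le> (1 / 2) ^ j + (1 / 2) ^ k"
      by (auto simp: max_def)
    then have "2 * (real p * \<delta>) * (1 / 2) ^ max j k \<le> 2 * (real p * \<delta>) * ((1 / 2) ^ j + (1 / 2) ^ k)"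
      using \<delta>0 by (intro mult_left_mono) auto
    then show ?thesis using off[OF jk False] False by simp
  qed
  have "(\<Sum>c\<in>{A..<B}. (norm (\<Sum>j<J. ee (g j * real c)))\<^sup>2)
      \<le> (\<Sum>j<J. \<Sum>k<J. norm (\<Sum>c\<in>{A..<B}. ee ((g j - g k) * real c)))"
    by (rule second_moment_le)
  also have "\<dots> \<le> (\<Sum>j<J. \<Sum>k<J. (if j = k then 2 * (real p * \<delta>) else 0)
        + 2 * (real p * \<delta>) * ((1 / 2) ^ j + (1 / 2) ^ k))"
    using ub by (intro sum_mono) auto
  also have "\<dots> = 2 * (real p * \<delta>) * real J
      + 2 * (real p * \<delta>) * (2 * (real J * (\<Sum>k<J. (1 / 2) ^ k)))"
    by (simp add: sum.distrib sum_distrib_left sum_distrib_right algebra_simps)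
  also have "\<dots> \<le> 2 * (real p * \<delta>) * real J + 2 * (real p * \<delta>) * (2 * (real J * 2))"
    using \<delta>0 by (intro add_left_mono mult_left_mono sum_half_powers_le) auto
  also have "\<dots> = 10 * (real p * \<delta>) * real J" by simp
  finally show ?thesis unfolding g_def .
qed

lemma prime_primroot_pow_cong:
  assumes "prime p" "residue_primroot p b" "j < p - 1" "k < p - 1" "[b ^ (L + j) = b ^ (L + k)] (mod p)"
  shows "j = k"
proof -
  have cop: "coprime p b" and ord: "ord p b = p - 1"
    using assms(1,2) by (auto simp: residue_primroot_def totient_prime)
  have "[L + j = L + k] (mod (p - 1))"
    using order_divides_expdiff[OF cop] assms(5) ord by auto
  then have "[j = k] (mod (p - 1))" by (simp add: cong_add_lcancel_nat)
  then show ?thesis using assms(3,4) by (simp add: cong_def)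
qed

text \<open>The powers \<open>b ^ (L + j)\<close> with \<open>j < p - 1\<close> are distinct modulo
  \<open>p\<close> and \<open>h\<close> is invertible, so every off-diagonal sum is that of a
  nontrivial character and vanishes. This holds for every starting position
  \<open>L\<close>.\<close>

lemma second_moment_full:
  fixes b h p L J :: nat
  assumes p: "prime p" and prim: "residue_primroot p b" and h: "h \<ge> 1" "h < p"
    and J: "J \<le> p - 1"
  shows "(\<Sum>c<p. (norm (\<Sum>j<J. ee (real h * real b ^ (L + j) / real p * real c)))\<^sup>2)
    \<le> real p * real J"
proof -
  define g where "g = (\<lambda>j. real h * real b ^ (L + j) / real p)"
  have p0: "p > 0" using p prime_gt_0_nat by blast
  have off: "(\<Sum>c<p. ee ((g j - g k) * real c)) = 0" if "j < J" "k < J" "j \<noteq> k" for j k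
  proof -
    let ?r = "int h * (int b ^ (L + j) - int b ^ (L + k))"
    have "\<not> int p dvd ?r"
    proof
      assume "int p dvd ?r"
      then have "int p dvd int h \<or> int p dvd int b ^ (L + j) - int b ^ (L + k)"
        using p prime_dvd_multD by (metis prime_nat_int_transfer)
      moreover have "\<not> p dvd h" using h by (auto dest: dvd_imp_le)
      ultimately have "[int (b ^ (L + j)) = int (b ^ (L + k))] (mod int p)"
        by (simp add: cong_iff_dvd_diff)
      then have "[b ^ (L + j) = b ^ (L + k)] (mod p)" by (simp only: cong_int_iff)
      then have "j = k" using prime_primroot_pow_cong[OF p prim] that J by auto
      with that show False by simp
    qed
    from sum_ee_multiples_prime[OF p0 this] show ?thesis
      by (simp add: g_def diff_divide_distrib right_diff_distrib)
  qed
  have "(\<Sum>c<p. (norm (\<Sum>j<J. ee (g j * real c)))\<^sup>2)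
      \<le> (\<Sum>j<J. \<Sum>k<J. norm (\<Sum>c<p. ee ((g j - g k) * real c)))"
    by (rule second_moment_le)
  also have "\<dots> \<le> (\<Sum>j<J. \<Sum>k<J. if j = k then real p else 0)"
    using off by (intro sum_mono) auto
  also have "\<dots> = real p * real J" by simp
  finally show ?thesis unfolding g_def .
qed

section \<open>Choice of a numerator by averaging\<close>

text \<open>A telescoping comparison with 1 / n - 1 / (n + 1). For \<open>k\<close> at least 1 /
  \<delta> the tail is at most \<delta>, which pays for enlarging the range of numerators from about
  \<open>p * \<delta>\<close> to \<open>p\<close>.\<close>

lemma sum_inverse_squares_tail:
  assumes "k \<ge> 1" "finite A" "A \<subseteq> {k<..}"
  shows "(\<Sum>t\<in>A. 1 / (real t)\<^sup>2) \<le> 1 / real k"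
proof -
  have *: "(\<Sum>t\<in>{k<..n}. 1 / (real t)\<^sup>2) \<le> 1 / real k - 1 / real n" if "n \<ge> k" for n
    using that
  proof (induction n rule: dec_induct)
    case (step n)
    have n: "real n > 0" using step assms by simp
    have eq: "{k<..Suc n} = insert (Suc n) {k<..n}" using step by auto
    have "1 / (real (Suc n))\<^sup>2 \<le> 1 / (real n * real (Suc n))"
      using n by (intro divide_left_mono) (auto simp: power2_eq_square intro: mult_right_mono)
    also have "\<dots> = 1 / real n - 1 / real (Suc n)"
      using n by (simp add: field_simps)
    finally show ?case using step.IH unfolding eq by simp
  qed simp
  obtain n where n: "A \<subseteq> {..n}"
    using assms(2) finite_nat_iff_bounded_le by auto
  have "(\<Sum>t\<in>A. 1 / (real t)\<^sup>2) \<le> (\<Sum>t\<in>{k<..max k n}. 1 / (real t)\<^sup>2)"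
    using n assms by (intro sum_mono2) (auto simp: subset_iff)
  also have "\<dots> \<le> 1 / real k - 1 / real (max k n)" by (rule *) simp
  also have "\<dots> \<le> 1 / real k" by simp
  finally show ?thesis .
qed

lemma sum_inverse_squares_le_2:
  assumes "finite A" "A \<subseteq> {1..}"
  shows "(\<Sum>t\<in>A. 1 / (real t)\<^sup>2) \<le> 2"
proof -
  have "(\<Sum>t\<in>A. 1 / (real t)\<^sup>2) \<le> (\<Sum>t\<in>insert 1 (A - {1}). 1 / (real t)\<^sup>2)"
    using assms by (intro sum_mono2) auto
  also have "\<dots> = 1 + (\<Sum>t\<in>A - {1}. 1 / (real t)\<^sup>2)"
    using assms by (subst sum.insert) auto
  also have "(\<Sum>t\<in>A - {1}. 1 / (real t)\<^sup>2) \<le> 1 / real 1"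
    using assms by (intro sum_inverse_squares_tail) force+
  finally show ?thesis by simp
qed

lemma exists_le_average:
  fixes F :: "'a \<Rightarrow> real"
  assumes "finite I" "I \<noteq> {}" "(\<Sum>c\<in>I. F c) \<le> K * real (card I)"
  shows "\<exists>c\<in>I. F c \<le> K"
proof (rule ccontr)
  assume "\<not> ?thesis"
  then have "(\<Sum>c\<in>I. K) < (\<Sum>c\<in>I. F c)"
    using assms by (intro sum_strict_mono) auto
  with assms show False by (simp add: mult.commute)
qed

text \<open>For each base and frequency the weighted second moments add up to at most
  \<open>21 * (real p * \<delta>)\<close>: 20 from the inverse squares with coefficient 10, and 1
  from the tail beyond \<open>k\<close>. At least \<open>real p * \<delta> / 2\<close> numerators
  are available, so some numerator satisfies the averaged bound with constant 42.\<close>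

lemma exists_good_numerator:
  fixes B :: "nat set" and P :: "nat set" and L :: "nat \<Rightarrow> nat" and H N :: nat and u \<delta> :: real
  assumes B: "finite B" "\<And>b. b \<in> B \<Longrightarrow> b \<ge> 2"
    and P: "infinite P" "\<And>p. p \<in> P \<Longrightarrow> prime p" "\<And>p b. p \<in> P \<Longrightarrow> b \<in> B \<Longrightarrow> residue_primroot p b"
    and u: "u \<ge> 0" "\<delta> > 0" "u + \<delta> \<le> 1"
    and L: "\<And>b. b \<in> B \<Longrightarrow> real b ^ L b * \<delta> \<ge> 1"
  shows "\<exists>p\<in>P. \<exists>c. p > N \<and> u < real c / real p \<and> real c / real p < u + \<delta> \<and>
    (\<forall>b\<in>B. \<forall>h\<in>{1..H}. \<forall>t\<ge>1. t ^ 3 \<le> p - 1 \<longrightarrow>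
      (norm (\<Sum>j<t ^ 3. ee (real h * real b ^ (L b + j) / real p * real c)))\<^sup>2
        \<le> 42 * real (card B) * real H * real t ^ 5)"
proof -
  define k where "k = nat \<lceil>1 / \<delta>\<rceil>"
  have k: "k \<ge> 1" "1 / real k \<le> \<delta>"
  proof -
    have pos: "1 / \<delta> > 0" using u by simp
    then show "k \<ge> 1" unfolding k_def by linarith
    have "1 / \<delta> \<le> real k" using pos unfolding k_def by linarith
    then show "1 / real k \<le> \<delta>" using u \<open>k \<ge> 1\<close> by (simp add: field_simps)
  qed
  \<comment> \<open>Requirements on \<open>p\<close>: \<open>N\<close> is prescribed,
    \<open>H\<close> makes each \<open>h\<close> invertible modulo \<open>p\<close>,
    \<open>4 * k\<close> ensures that the interval contains about \<open>real p * \<delta>\<close>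
    fractions, and the sum validates the short window estimate for all
    \<open>t \<le> k\<close>.\<close>
  define N' where "N' = N + H + 4 * k + (\<Sum>b\<in>B. 3 * H * b ^ (L b + k ^ 3))"
  obtain p where p: "p \<in> P" "p > N'"
    using P(1) by (meson infinite_nat_iff_unbounded)
  have prime: "prime p" using P p by auto
  have p0: "p > 0" using p by simp
  have long: "3 * h * b ^ (L b + t ^ 3) \<le> p" if "b \<in> B" "h \<le> H" "t \<le> k" for b h t
  proof -
    have "3 * h * b ^ (L b + t ^ 3) \<le> 3 * H * b ^ (L b + k ^ 3)"
      using that B(2)[of b] by (intro mult_mono power_increasing power_mono add_left_mono) auto
    also have "\<dots> \<le> (\<Sum>b\<in>B. 3 * H * b ^ (L b + k ^ 3))"
      using B that by (intro member_le_sum) auto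
    finally show ?thesis using p unfolding N'_def by linarith
  qed
  have p\<delta>: "real p * \<delta> \<ge> 4"
  proof -
    have "4 * real k \<le> real p" using p unfolding N'_def by linarith
    then have "4 * real k * \<delta> \<le> real p * \<delta>" using u by (intro mult_right_mono) auto
    moreover have "1 \<le> real k * \<delta>" using k by (simp add: field_simps)
    ultimately show ?thesis by linarith
  qed
  \<comment> \<open>\<open>{A..<C}\<close> consists of exactly those \<open>c\<close> for which c /
    p lies strictly between \<open>u\<close> and \<open>u + \<delta>\<close>.\<close>
  define A where "A = nat \<lfloor>u * real p\<rfloor> + 1"
  define C where "C = nat \<lceil>(u + \<delta>) * real p\<rceil>"
  have up: "u * real p \<ge> 0" using u by simp
  have expand: "(u + \<delta>) * real p = u * real p + real p * \<delta>" by (simp add: algebra_simps)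
  have A: "real A = of_int \<lfloor>u * real p\<rfloor> + 1" using up by (simp add: A_def)
  have C: "real C = of_int \<lceil>(u + \<delta>) * real p\<rceil>" using up p\<delta> expand by (simp add: C_def)
  have AC: "A \<le> C" "real p * \<delta> \<le> 2 * real (C - A)" "real (C - A) \<le> 2 * (real p * \<delta>)"
  proof -
    have 1: "real C - real A \<ge> real p * \<delta> - 1" "real C - real A \<le> real p * \<delta> + 1"
      using A C expand by linarith+
    then show "A \<le> C" using p\<delta> by linarith
    with 1 p\<delta> show "real p * \<delta> \<le> 2 * real (C - A)" "real (C - A) \<le> 2 * (real p * \<delta>)"
      by (auto simp: of_nat_diff)
  qed
  have Cp: "C \<le> p"
  proof -
    have "(u + \<delta>) * real p \<le> 1 * real p" using u by (intro mult_right_mono) auto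
    then show ?thesis using C by linarith
  qed
  have range: "u < real c / real p \<and> real c / real p < u + \<delta>" if c: "c \<in> {A..<C}" for c
  proof -
    have "real c \<ge> real A" "real c + 1 \<le> real C" using c by auto
    then have "u * real p < real c" "real c < (u + \<delta>) * real p"
      using A C by linarith+
    then show ?thesis using p0 by (simp add: field_simps)
  qed
  define TT where "TT = {t. t \<ge> 1 \<and> t ^ 3 \<le> p - 1}"
  have finTT: "finite TT"
  proof (rule finite_subset)
    show "TT \<subseteq> {..p}"
    proof
      fix t assume "t \<in> TT"
      then have "t \<le> t ^ 3" "t ^ 3 \<le> p - 1" using self_le_power[of t 3] by (auto simp: TT_def)
      then show "t \<in> {..p}" by simp
    qed
  qed simp
  define V where "V = (\<lambda>c b h t. (norm (\<Sum>j<t ^ 3. ee (real h * real b ^ (L b + j) / real p * real c)))\<^sup>2)"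
  \<comment> \<open>The moment is of order t ^ 3, so the weight t ^ (-5) leaves the summable t ^
    (-2). The cut at \<open>k\<close> decides which of the two moment estimates is used.\<close>
  have Vsum: "(\<Sum>c\<in>{A..<C}. V c b h t) / real t ^ 5
      \<le> 10 * (real p * \<delta>) * (1 / (real t)\<^sup>2) + (if t \<le> k then 0 else real p * (1 / (real t)\<^sup>2))"
    if bht: "b \<in> B" "h \<in> {1..H}" "t \<in> TT" for b h t
  proof -
    have t: "t \<ge> 1" "t ^ 3 \<le> p - 1" using bht by (auto simp: TT_def)
    have t5: "real t ^ 3 / real t ^ 5 = 1 / (real t)\<^sup>2"
    proof -
      have "real t ^ 5 = real t ^ 3 * (real t)\<^sup>2" by (simp flip: power_add)
      moreover have "real t ^ 3 / (real t ^ 3 * (real t)\<^sup>2) = 1 / (real t)\<^sup>2"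
        by (rule nonzero_divide_mult_cancel_left) (use t in simp)
      ultimately show ?thesis by (simp only:)
    qed
    have h: "h \<ge> 1" "h \<le> H" "h < p" using bht p by (auto simp: N'_def)
    show ?thesis
    proof (cases "t \<le> k")
      case True
      have "(\<Sum>c\<in>{A..<C}. V c b h t) \<le> 10 * (real p * \<delta>) * real (t ^ 3)"
        unfolding V_def using B(2) L AC bht h p0 long True by (intro second_moment_short_window) auto
      then have "(\<Sum>c\<in>{A..<C}. V c b h t) / real t ^ 5 \<le> 10 * (real p * \<delta>) * real (t ^ 3) / real t ^ 5"
        by (intro divide_right_mono) auto
      also have "\<dots> = 10 * (real p * \<delta>) * (1 / (real t)\<^sup>2)" by (simp flip: t5)
      finally show ?thesis using True by simp
    next
      case False
      have "(\<Sum>c\<in>{A..<C}. V c b h t) \<le> (\<Sum>c<p. V c b h t)"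
        using Cp by (intro sum_mono2) (auto simp: V_def)
      also have "\<dots> \<le> real p * real (t ^ 3)"
        unfolding V_def using prime P(3)[OF p(1)] bht h t by (intro second_moment_full) auto
      finally have "(\<Sum>c\<in>{A..<C}. V c b h t) / real t ^ 5 \<le> real p * real (t ^ 3) / real t ^ 5"
        by (intro divide_right_mono) auto
      also have "\<dots> = real p * (1 / (real t)\<^sup>2)" by (simp flip: t5)
      finally show ?thesis using False p\<delta> zero_le_power2[of "real t"] by (simp add: add_increasing)
    qed
  qed
  have inner: "(\<Sum>t\<in>TT. (\<Sum>c\<in>{A..<C}. V c b h t) / real t ^ 5) \<le> 21 * (real p * \<delta>)"
    if bh: "b \<in> B" "h \<in> {1..H}" for b h
  proof -
    have "(\<Sum>t\<in>TT. (\<Sum>c\<in>{A..<C}. V c b h t) / real t ^ 5)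
        \<le> (\<Sum>t\<in>TT. 10 * (real p * \<delta>) * (1 / (real t)\<^sup>2)
             + (if t \<le> k then 0 else real p * (1 / (real t)\<^sup>2)))"
      using Vsum bh by (intro sum_mono) auto
    also have "\<dots> = 10 * (real p * \<delta>) * (\<Sum>t\<in>TT. 1 / (real t)\<^sup>2)
        + real p * (\<Sum>t\<in>TT \<inter> {k<..}. 1 / (real t)\<^sup>2)"
    proof -
      have "(\<Sum>t\<in>TT. if t \<le> k then 0 else real p * (1 / (real t)\<^sup>2))
          = (\<Sum>t\<in>TT \<inter> {k<..}. real p * (1 / (real t)\<^sup>2))"
        using finTT by (intro sum.mono_neutral_cong_right) auto
      then show ?thesis by (simp add: sum.distrib sum_distrib_left)
    qed
    also have "\<dots> \<le> 10 * (real p * \<delta>) * 2 + real p * (1 / real k)"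
      using p\<delta> finTT k
      by (intro add_mono mult_left_mono sum_inverse_squares_le_2 sum_inverse_squares_tail)
        (auto simp: TT_def)
    also have "\<dots> \<le> 10 * (real p * \<delta>) * 2 + real p * \<delta>"
      using k by (intro add_left_mono mult_left_mono) auto
    finally show ?thesis by linarith
  qed
  define F where "F = (\<lambda>c. \<Sum>b\<in>B. \<Sum>h\<in>{1..H}. \<Sum>t\<in>TT. V c b h t / real t ^ 5)"
  have "(\<Sum>c\<in>{A..<C}. F c)
      = (\<Sum>b\<in>B. \<Sum>h\<in>{1..H}. \<Sum>t\<in>TT. (\<Sum>c\<in>{A..<C}. V c b h t) / real t ^ 5)"
  proof -
    have "(\<Sum>c\<in>{A..<C}. F c)
        = (\<Sum>b\<in>B. \<Sum>c\<in>{A..<C}. \<Sum>h\<in>{1..H}. \<Sum>t\<in>TT. V c b h t / real t ^ 5)"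
      unfolding F_def by (rule sum.swap)
    also have "\<dots> = (\<Sum>b\<in>B. \<Sum>h\<in>{1..H}. \<Sum>c\<in>{A..<C}. \<Sum>t\<in>TT. V c b h t / real t ^ 5)"
      by (rule sum.cong[OF refl]) (rule sum.swap)
    also have "\<dots> = (\<Sum>b\<in>B. \<Sum>h\<in>{1..H}. \<Sum>t\<in>TT. \<Sum>c\<in>{A..<C}. V c b h t / real t ^ 5)"
      by (rule sum.cong[OF refl], rule sum.cong[OF refl], rule sum.swap)
    finally show ?thesis by (simp only: sum_divide_distrib)
  qed
  also have "\<dots> \<le> (\<Sum>b\<in>B. \<Sum>h\<in>{1..H}. 21 * (real p * \<delta>))"
    using inner by (intro sum_mono) auto
  also have "\<dots> = real (card B) * real H * 21 * (real p * \<delta>)" by simp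
  also have "\<dots> \<le> real (card B) * real H * 21 * (2 * real (C - A))"
    using AC by (intro mult_left_mono) auto
  finally have "(\<Sum>c\<in>{A..<C}. F c) \<le> (42 * real (card B) * real H) * real (card {A..<C})"
    by simp
  moreover have "{A..<C} \<noteq> {}" using AC p\<delta> by auto
  ultimately obtain c where c: "c \<in> {A..<C}" "F c \<le> 42 * real (card B) * real H"
    using exists_le_average[of "{A..<C}"] by blast
  \<comment> \<open>All terms of \<open>F c\<close> are nonnegative, so each of them obeys the bound
    for the whole sum.\<close>
  have "V c b h t \<le> 42 * real (card B) * real H * real t ^ 5"
    if bht: "b \<in> B" "h \<in> {1..H}" "t \<ge> 1" "t ^ 3 \<le> p - 1" for b h t
  proof -
    have V0: "V c b h t / real t ^ 5 \<ge> 0" for b h t by (simp add: V_def)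
    have "V c b h t / real t ^ 5 \<le> (\<Sum>t\<in>TT. V c b h t / real t ^ 5)"
      using bht finTT V0 by (intro member_le_sum) (auto simp: TT_def)
    also have "\<dots> \<le> (\<Sum>h\<in>{1..H}. \<Sum>t\<in>TT. V c b h t / real t ^ 5)"
      using bht V0 by (intro member_le_sum[of h "{1..H}" "\<lambda>h. \<Sum>t\<in>TT. V c b h t / real t ^ 5"] sum_nonneg) auto
    also have "\<dots> \<le> F c"
      unfolding F_def using bht B V0
      by (intro member_le_sum[of b B "\<lambda>b. \<Sum>h\<in>{1..H}. \<Sum>t\<in>TT. V c b h t / real t ^ 5"] sum_nonneg) auto
    also have "\<dots> \<le> 42 * real (card B) * real H" by fact
    finally show ?thesis using bht by (simp add: pos_divide_le_eq)
  qed
  moreover have "p > N" using p by (simp add: N'_def)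
  ultimately show ?thesis using p(1) range[OF c(1)] unfolding V_def by blast
qed

section \<open>From cubes to all lengths, and periodicity\<close>

text \<open>Cubes are dense enough: between t ^ 3 and (t + 1) ^ 3 at most 7 t ^ 2 terms are added,
  and both this and the square root of K t ^ 5 are o(t ^ 3). The constant \<open>T\<close> depends
  only on \<open>K\<close> and \<open>\<epsilon>\<close>, not on the sequence or on
  \<open>m\<close>.\<close>

lemma norm_sum_le_from_cubes:
  fixes K \<epsilon> :: real
  assumes "K \<ge> 0" "\<epsilon> > 0"
  shows "\<exists>T\<ge>0. \<forall>(s :: nat \<Rightarrow> complex) m. (\<forall>j. norm (s j) \<le> 1) \<longrightarrow>
    (\<forall>t\<ge>1. t ^ 3 \<le> m \<longrightarrow> (norm (\<Sum>j<t ^ 3. s j))\<^sup>2 \<le> K * real t ^ 5) \<longrightarrow>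
    (\<forall>J\<le>m. norm (\<Sum>j<J. s j) \<le> \<epsilon> * real J + T)"
proof -
  \<comment> \<open>The first summand makes the square root of K t ^ 5 at most
    \<open>\<epsilon> / 2 * real t ^ 3\<close>, the second does the same for 7 t ^ 2. Below
    \<open>(t1 + 1) ^ 3\<close> the trivial bound is put into \<open>T\<close>.\<close>
  define t1 where "t1 = nat \<lceil>4 * K / \<epsilon>\<^sup>2 + 14 / \<epsilon>\<rceil>"
  have "4 * K / \<epsilon>\<^sup>2 \<ge> 0" "14 / \<epsilon> \<ge> 0" using assms by auto
  then have t1: "4 * K / \<epsilon>\<^sup>2 \<le> real t1" "14 / \<epsilon> \<le> real t1"
    unfolding t1_def by linarith+
  define T where "T = real ((t1 + 1) ^ 3)"
  have "norm (\<Sum>j<J. s j) \<le> \<epsilon> * real J + T"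
    if s: "\<forall>j. norm (s j) \<le> 1" and cubes: "\<forall>t\<ge>1. t ^ 3 \<le> m \<longrightarrow> (norm (\<Sum>j<t ^ 3. s j))\<^sup>2 \<le> K * real t ^ 5"
      and J: "J \<le> m" for s :: "nat \<Rightarrow> complex" and m J
  proof -
    have triv: "norm (\<Sum>j\<in>A. s j) \<le> real (card A)" for A
      using sum_norm_bound[of A s 1] s by simp
    show ?thesis
    proof (cases "J < (t1 + 1) ^ 3")
      case True
      then have "real J \<le> T" unfolding T_def by (intro of_nat_mono) simp
      then have "norm (\<Sum>j<J. s j) \<le> T" using triv[of "{..<J}"] by simp
      then show ?thesis using assms by (intro add_increasing) auto
    next
      case False
      have "\<exists>t. t ^ 3 \<le> J \<and> J < (Suc t) ^ 3"
      proof -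
        have "J < (Suc J) ^ 3"
          using self_le_power[of "Suc J" 3] by simp
        then have ex: "\<exists>t. J < (Suc t) ^ 3" by blast
        define t where "t = (LEAST t. J < (Suc t) ^ 3)"
        have 1: "J < (Suc t) ^ 3" unfolding t_def using ex by (rule LeastI_ex)
        have "t ^ 3 \<le> J"
        proof (cases t)
          case (Suc r)
          then have "\<not> J < (Suc r) ^ 3" using not_less_Least[of r "\<lambda>t. J < (Suc t) ^ 3"] t_def by simp
          then show ?thesis using Suc by simp
        qed simp
        with 1 show ?thesis by blast
      qed
      then obtain t where t: "t ^ 3 \<le> J" "J < (Suc t) ^ 3" by blast
      have tt1: "t1 + 1 \<le> t"
      proof (rule ccontr)
        assume "\<not> t1 + 1 \<le> t"
        then have "(Suc t) ^ 3 \<le> (t1 + 1) ^ 3" by (intro power_mono) auto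
        with False t show False by linarith
      qed
      have t0: "real t > 0" "real t \<ge> 1" using tt1 by auto
      have "(norm (\<Sum>j<t ^ 3. s j))\<^sup>2 \<le> K * real t ^ 5"
        using cubes tt1 t J by auto
      also have "K * real t ^ 5 \<le> \<epsilon>\<^sup>2 / 4 * real t * real t ^ 5"
      proof (rule mult_right_mono)
        have "4 * K / \<epsilon>\<^sup>2 \<le> real t" using t1(1) tt1 by linarith
        then show "K \<le> \<epsilon>\<^sup>2 / 4 * real t" using assms by (simp add: field_simps)
      qed simp
      also have "\<dots> = (\<epsilon> / 2 * real t ^ 3)\<^sup>2"
      proof -
        have "real t * real t ^ 5 = (real t ^ 3)\<^sup>2"
          by (simp only: power_mult[symmetric] power_Suc[symmetric]) simp
        moreover have "(\<epsilon> / 2 * real t ^ 3)\<^sup>2 = \<epsilon>\<^sup>2 / 4 * (real t ^ 3)\<^sup>2"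
          by (simp only: power_mult_distrib power_divide) simp
        ultimately show ?thesis by (simp only: mult.assoc)
      qed
      finally have n1: "norm (\<Sum>j<t ^ 3. s j) \<le> \<epsilon> / 2 * real t ^ 3"
        by (rule power2_le_imp_le) (use assms in simp)
      have "norm (\<Sum>j\<in>{t ^ 3..<J}. s j) \<le> real (J - t ^ 3)"
        using triv[of "{t ^ 3..<J}"] by simp
      also have "\<dots> \<le> 3 * (real t)\<^sup>2 + 3 * real t + 1"
      proof -
        have "real J \<le> (real t + 1) ^ 3"
          using of_nat_mono[OF less_imp_le[OF t(2)], where 'a = real] by (simp add: add.commute)
        moreover have "(real t + 1) ^ 3 = real (t ^ 3) + 3 * (real t)\<^sup>2 + 3 * real t + 1"
          by (simp add: power3_eq_cube power2_eq_square algebra_simps)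
        ultimately show ?thesis using t(1) by (simp add: of_nat_diff)
      qed
      also have "\<dots> \<le> 7 * (real t)\<^sup>2"
      proof -
        have "1 * real t \<le> real t * real t" using t0(2) by (intro mult_right_mono) auto
        then show ?thesis using t0(2) unfolding power2_eq_square by linarith
      qed
      also have "\<dots> \<le> \<epsilon> / 2 * real t ^ 3"
      proof -
        have "14 / \<epsilon> \<le> real t" using t1(2) tt1 by linarith
        then have "7 \<le> \<epsilon> / 2 * real t" using assms by (simp add: field_simps)
        then have "7 * (real t)\<^sup>2 \<le> \<epsilon> / 2 * real t * (real t)\<^sup>2" by (intro mult_right_mono) auto
        then show ?thesis by (simp add: power3_eq_cube power2_eq_square mult_ac)
      qed
      finally have n2: "norm (\<Sum>j\<in>{t ^ 3..<J}. s j) \<le> \<epsilon> / 2 * real t ^ 3" .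
      have "(\<Sum>j<J. s j) = (\<Sum>j<t ^ 3. s j) + (\<Sum>j\<in>{t ^ 3..<J}. s j)"
        using t(1) sum.atLeastLessThan_concat[of 0 "t ^ 3" J s] by (simp add: lessThan_atLeast0)
      then have "norm (\<Sum>j<J. s j) \<le> \<epsilon> / 2 * real t ^ 3 + \<epsilon> / 2 * real t ^ 3"
        using n1 n2 norm_triangle_ineq[of "\<Sum>j<t ^ 3. s j" "\<Sum>j\<in>{t ^ 3..<J}. s j"] by simp
      also have "\<dots> = \<epsilon> * real (t ^ 3)" by simp
      also have "\<dots> \<le> \<epsilon> * real J" using t(1) assms by (intro mult_left_mono) auto
      finally show ?thesis by (simp add: T_def add_increasing2)
    qed
  qed
  moreover have "T \<ge> 0" by (simp add: T_def)
  ultimately show ?thesis by blast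
qed

text \<open>Each full period removed from the front costs at most 1, which the extra slope
  \<open>1 / real m\<close> repays over \<open>m\<close> terms.\<close>

lemma norm_sum_le_periodic:
  fixes s :: "nat \<Rightarrow> complex"
  assumes "\<epsilon> \<ge> 0" and m: "m > 0" and per: "\<And>j. s (m + j) = s j" and full: "norm (\<Sum>j<m. s j) \<le> 1"
    and part: "\<And>J. J \<le> m \<Longrightarrow> norm (\<Sum>j<J. s j) \<le> \<epsilon> * real J + T"
  shows "norm (\<Sum>j<J. s j) \<le> (\<epsilon> + 1 / real m) * real J + T"
proof (induction J rule: less_induct)
  case (less J)
  show ?case
  proof (cases "J \<le> m")
    case True
    have "(\<epsilon> + 1 / real m) * real J \<ge> \<epsilon> * real J" by (simp add: algebra_simps)
    then show ?thesis using part[OF True] by linarith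
  next
    case False
    define k where "k = J - m"
    have k: "J = m + k" using False by (simp add: k_def)
    have "(\<Sum>j<m + k. s j) = (\<Sum>j<m. s j) + (\<Sum>j<k. s j)" for k
      by (induction k) (auto simp: per)
    then have "norm (\<Sum>j<J. s j) \<le> 1 + norm (\<Sum>j<k. s j)"
      using full norm_triangle_ineq[of "\<Sum>j<m. s j" "\<Sum>j<k. s j"] unfolding k by simp
    also have "\<dots> \<le> 1 + ((\<epsilon> + 1 / real m) * real k + T)"
      using less.IH[of k] k m by (intro add_left_mono) linarith
    also have "\<dots> \<le> (\<epsilon> + 1 / real m) * real m + ((\<epsilon> + 1 / real m) * real k + T)"
    proof -
      have "(\<epsilon> + 1 / real m) * real m = \<epsilon> * real m + 1" using m by (simp add: distrib_right)
      moreover have "\<epsilon> * real m \<ge> 0" using assms(1) by simp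
      ultimately show ?thesis by linarith
    qed
    finally show ?thesis unfolding k by (simp only: of_nat_add distrib_left add.assoc)
  qed
qed

text \<open>The powers of a primitive root run through all nonzero residues, so the sum is a
  complete character sum, which is 0, without its term 1 at residue 0.\<close>

lemma sum_ee_full_period:
  fixes p b r :: nat
  assumes p: "prime p" and prim: "residue_primroot p b" and r: "\<not> p dvd r"
  shows "(\<Sum>j<p - 1. ee (real r * real b ^ j / real p)) = -1"
proof -
  have p1: "p > 1" using p prime_gt_1_nat by blast
  have bij: "bij_betw (\<lambda>j. b ^ j mod p) {..<p - 1} {1..<p}"
  proof -
    have "bij_betw (\<lambda>j. b ^ j mod p) {..<totient p} (totatives p)"
      by (rule residue_primroot_is_generator[OF p1 prim])
    moreover have "totatives p = {1..<p}"
      unfolding totatives_prime[OF p] by auto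
    ultimately show ?thesis unfolding totient_prime[OF p] by (simp only:)
  qed
  have "(\<Sum>j<p - 1. ee (real r * real b ^ j / real p))
      = (\<Sum>j<p - 1. ee (real r / real p * real (b ^ j mod p)))"
  proof (intro sum.cong refl ee_cong)
    fix j
    have "real (b ^ j) = real (b ^ j div p) * real p + real (b ^ j mod p)"
      by (metis div_mult_mod_eq of_nat_add of_nat_mult)
    then have "real r * real b ^ j / real p - real r / real p * real (b ^ j mod p) = real (r * (b ^ j div p))"
      using p1 by (simp add: field_simps)
    then show "real r * real b ^ j / real p - real r / real p * real (b ^ j mod p) \<in> \<int>"
      by (metis Ints_of_nat)
  qed
  also have "\<dots> = (\<Sum>a\<in>{1..<p}. ee (real r / real p * real a))"
    by (rule sum.reindex_bij_betw[OF bij])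
  also have "\<dots> = (\<Sum>a<p. ee (real r / real p * real a)) - 1"
  proof -
    have "{..<p} = insert 0 {1..<p}" using p1 by auto
    then show ?thesis by simp
  qed
  also have "(\<Sum>a<p. ee (real r / real p * real a)) = 0"
    using sum_ee_multiples_prime[of p "int r"] p1 r by simp
  finally show ?thesis by simp
qed

text \<open>\<open>T\<close> is fixed before the interval and the positions \<open>L\<close> are
  given. The construction depends on this order: it first shrinks the interval until the constant of
  the next fraction is absorbed, and only then picks that fraction.\<close>

lemma uniform_good_fraction:
  fixes B :: "nat set" and P :: "nat set" and H :: nat and \<epsilon> :: real
  assumes B: "finite B" "\<And>b. b \<in> B \<Longrightarrow> b \<ge> 2"
    and P: "infinite P" "\<And>p. p \<in> P \<Longrightarrow> prime p" "\<And>p b. p \<in> P \<Longrightarrow> b \<in> B \<Longrightarrow> residue_primroot p b"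
    and \<epsilon>: "\<epsilon> > 0"
  shows "\<exists>T\<ge>0. \<forall>u \<delta> L. u \<ge> 0 \<longrightarrow> \<delta> > 0 \<longrightarrow> u + \<delta> \<le> 1 \<longrightarrow> (\<forall>b\<in>B. real b ^ L b * \<delta> \<ge> 1) \<longrightarrow>
    (\<exists>p c :: nat. p > 1 \<and> u < real c / real p \<and> real c / real p < u + \<delta> \<and>
      (\<forall>b\<in>B. \<forall>h\<in>{1..H}. \<forall>J.
        norm (\<Sum>j<J. ee (real h * real b ^ (L b + j) * (real c / real p))) \<le> \<epsilon> * real J + T))"
proof -
  define K where "K = 42 * real (card B) * real H"
  have "K \<ge> 0" "\<epsilon> / 2 > 0" using \<epsilon> by (auto simp: K_def)
  from norm_sum_le_from_cubes[OF this] obtain T where T: "T \<ge> 0" and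
    cubes: "\<And>(s :: nat \<Rightarrow> complex) m J. \<forall>j. norm (s j) \<le> 1 \<Longrightarrow>
      \<forall>t\<ge>1. t ^ 3 \<le> m \<longrightarrow> (norm (\<Sum>j<t ^ 3. s j))\<^sup>2 \<le> K * real t ^ 5 \<Longrightarrow>
      J \<le> m \<Longrightarrow> norm (\<Sum>j<J. s j) \<le> \<epsilon> / 2 * real J + T"
    by blast
  have "\<exists>p c :: nat. p > 1 \<and> u < real c / real p \<and> real c / real p < u + \<delta> \<and>
      (\<forall>b\<in>B. \<forall>h\<in>{1..H}. \<forall>J.
        norm (\<Sum>j<J. ee (real h * real b ^ (L b + j) * (real c / real p))) \<le> \<epsilon> * real J + T)"
    if u: "u \<ge> 0" "\<delta> > 0" "u + \<delta> \<le> 1" and L: "\<forall>b\<in>B. real b ^ L b * \<delta> \<ge> 1" for u \<delta> L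
  proof -
    \<comment> \<open>\<open>p > N\<close> makes every \<open>h \<le> H\<close> prime to
      \<open>p\<close> and leaves at most \<open>\<epsilon> / 2\<close> for the slope
      \<open>1 / real (p - 1)\<close> lost to periodicity.\<close>
    define N where "N = H + nat \<lceil>2 / \<epsilon>\<rceil> + 1"
    obtain p c where p: "p \<in> P" "p > N" and c: "u < real c / real p" "real c / real p < u + \<delta>"
      and good: "\<forall>b\<in>B. \<forall>h\<in>{1..H}. \<forall>t\<ge>1. t ^ 3 \<le> p - 1 \<longrightarrow>
      (norm (\<Sum>j<t ^ 3. ee (real h * real b ^ (L b + j) / real p * real c)))\<^sup>2 \<le> K * real t ^ 5"
      using exists_good_numerator[where N = N, OF B P u, of L H] L unfolding K_def by blast
    have prime: "prime p" using P p by auto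
    have p1: "p > 1" using p by (simp add: N_def)
    have "0 < real c / real p" "real c / real p < 1" using c u by linarith+
    then have cp: "0 < c" "c < p" using p1 by (auto simp: field_simps)
    have small: "1 / real (p - 1) \<le> \<epsilon> / 2"
    proof -
      have "2 / \<epsilon> \<le> real (p - 1)" using p \<epsilon> unfolding N_def by linarith
      then show ?thesis using \<epsilon> p1 by (simp add: field_simps)
    qed
    have "norm (\<Sum>j<J. ee (real h * real b ^ (L b + j) * (real c / real p))) \<le> \<epsilon> * real J + T"
      if bh: "b \<in> B" "h \<in> {1..H}" for b h J
    proof -
      define s where "s = (\<lambda>j. ee (real h * real b ^ (L b + j) * (real c / real p)))"
      \<comment> \<open>Starting at position \<open>L b\<close> only changes the numerator: the
        window is an initial Weyl sum of r / p. Here \<open>p\<close> does not divide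
        \<open>r\<close>, since \<open>h\<close> and \<open>c\<close> lie strictly between 0 and
        \<open>p\<close> and \<open>b\<close> is prime to \<open>p\<close>.\<close>
      define r where "r = h * b ^ L b * c"
      have prim: "residue_primroot p b" using P p bh by auto
      have cop: "coprime p b" using prim by (auto simp: residue_primroot_def)
      have "\<not> p dvd b"
        using cop p1 by (auto simp: coprime_absorb_left)
      moreover have "h < p" using p bh by (auto simp: N_def)
      ultimately have ndvd: "\<not> p dvd r"
        using bh cp prime by (auto simp: r_def prime_dvd_mult_iff dest: prime_dvd_power dvd_imp_le)
      have s_eq: "s j = ee (real r * real b ^ j / real p)" for j
        by (simp add: s_def r_def power_add mult_ac)
      have full: "norm (\<Sum>j<p - 1. s j) \<le> 1"
        using sum_ee_full_period[OF prime prim ndvd] by (simp add: s_eq)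
      have per: "s (p - 1 + j) = s j" for j
        unfolding s_eq
      proof (rule ee_cong)
        have "[b ^ (p - 1) = 1] (mod p)"
          using fermat_theorem[OF prime] \<open>\<not> p dvd b\<close> by simp
        then have "[int (b ^ (p - 1)) = int 1] (mod int p)" by (simp only: cong_int_iff)
        then obtain q where q: "int (b ^ (p - 1)) - int 1 = int p * q"
          by (metis cong_iff_dvd_diff dvdE)
        have "real b ^ (p - 1) - 1 = of_int (int (b ^ (p - 1)) - int 1)" by simp
        also have "\<dots> = real p * of_int q" unfolding q by simp
        finally have q': "real b ^ (p - 1) - 1 = real p * of_int q" .
        have "real r * real b ^ (p - 1 + j) / real p - real r * real b ^ j / real p
            = real r * real b ^ j * (real b ^ (p - 1) - 1) / real p"
          by (simp add: power_add right_diff_distrib diff_divide_distrib mult_ac)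
        also have "\<dots> = of_int (int r * int b ^ j * q)"
          unfolding q' using p1 by simp
        finally show "real r * real b ^ (p - 1 + j) / real p - real r * real b ^ j / real p \<in> \<int>"
          by (metis Ints_of_int)
      qed
      have part: "norm (\<Sum>j<J. s j) \<le> \<epsilon> / 2 * real J + T" if "J \<le> p - 1" for J
      proof (rule cubes[OF _ _ that])
        show "\<forall>j. norm (s j) \<le> 1" by (simp add: s_def)
        show "\<forall>t\<ge>1. t ^ 3 \<le> p - 1 \<longrightarrow> (norm (\<Sum>j<t ^ 3. s j))\<^sup>2 \<le> K * real t ^ 5"
          using good bh by (simp add: s_def)
      qed
      have "norm (\<Sum>j<J. s j) \<le> (\<epsilon> / 2 + 1 / real (p - 1)) * real J + T"
        using \<epsilon> p1 full per part by (intro norm_sum_le_periodic) auto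
      also have "\<dots> \<le> \<epsilon> * real J + T"
        using small by (intro add_right_mono mult_right_mono) auto
      finally show ?thesis unfolding s_def .
    qed
    then show ?thesis using p1 c by blast
  qed
  then show ?thesis using T by blast
qed

section \<open>Weyl's criterion for normality\<close>

text \<open>The points are not reduced modulo 1; the notion expresses equidistribution modulo 1 when
  it is applied to functions of period 1, whose mean is the integral over the unit interval.\<close>

definition mean_conv :: "(nat \<Rightarrow> real) \<Rightarrow> (real \<Rightarrow> complex) \<Rightarrow> bool" where
  "mean_conv y f \<longleftrightarrow> f integrable_on {0..1} \<and>
     (\<lambda>J. (\<Sum>j<J. f (y j)) / of_nat J) \<longlonglongrightarrow> integral {0..1} f"

lemma mean_conv_add:
  assumes "mean_conv y f" "mean_conv y g"
  shows "mean_conv y (\<lambda>x. f x + g x)"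
  using assms tendsto_add[of _ "integral {0..1} f" sequentially _ "integral {0..1} g"]
  by (auto simp: mean_conv_def integral_add integrable_add sum.distrib add_divide_distrib)

lemma mean_conv_cmult:
  assumes "mean_conv y f"
  shows "mean_conv y (\<lambda>x. c * f x)"
proof -
  have "(\<lambda>J. c * ((\<Sum>j<J. f (y j)) / of_nat J)) \<longlonglongrightarrow> c * integral {0..1} f"
    using assms by (intro tendsto_mult_left) (simp add: mean_conv_def)
  then show ?thesis
    using assms by (simp add: mean_conv_def integrable_on_mult_right sum_distrib_left)
qed

lemma mean_conv_sum:
  assumes "finite A" "\<And>i. i \<in> A \<Longrightarrow> mean_conv y (f i)"
  shows "mean_conv y (\<lambda>x. \<Sum>i\<in>A. f i x)"
  using assms
proof (induction A rule: finite_induct)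
  case empty
  then show ?case by (simp add: mean_conv_def integrable_continuous_real)
next
  case (insert a A)
  then show ?case using mean_conv_add[of y "f a"] by simp
qed

text \<open>The hypothesis covers positive frequencies; conjugation yields the negative ones, and
  frequency 0 is the constant function 1.\<close>

lemma mean_conv_ee:
  fixes h :: int
  assumes weyl: "\<And>h::nat. h \<ge> 1 \<Longrightarrow> (\<lambda>J. (\<Sum>j<J. ee (real h * y j)) / of_nat J) \<longlonglongrightarrow> 0"
  shows "mean_conv y (\<lambda>x. ee (of_int h * x))"
proof (cases "h = 0")
  case True
  have "(\<lambda>J. (\<Sum>j<J. 1) / of_nat J :: complex) \<longlonglongrightarrow> 1"
  proof (rule tendsto_eventually)
    show "\<forall>\<^sub>F J in sequentially. (\<Sum>j<J. 1) / of_nat J = (1 :: complex)"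
      using eventually_gt_at_top[of 0] by eventually_elim simp
  qed
  then show ?thesis
    using True by (simp only: mean_conv_def) (simp add: integrable_continuous_real del: sum_constant)
next
  case False
  have conv: "(\<lambda>J. (\<Sum>j<J. ee (of_int h * y j)) / of_nat J) \<longlonglongrightarrow> 0"
  proof (cases "h > 0")
    case True
    then have "real (nat h) = of_int h" "nat h \<ge> 1" by auto
    then show ?thesis using weyl[of "nat h"] by simp
  next
    case neg: False
    then have *: "real (nat (- h)) = - of_int h" "nat (- h) \<ge> 1" using False by auto
    have "(\<lambda>J. cnj ((\<Sum>j<J. ee (real (nat (- h)) * y j)) / of_nat J)) \<longlonglongrightarrow> cnj 0"
      using weyl[OF *(2)] by (intro tendsto_cnj)
    then show ?thesis using * by (simp add: cnj_ee)
  qed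
  let ?a = "\<i> * of_real (2 * pi * of_int h)"
  have a: "?a \<noteq> 0" using False by simp
  have "((\<lambda>x. ee (of_int h * x)) has_integral
      exp (?a * of_real 1) / ?a - exp (?a * of_real 0) / ?a) {0..1}"
  proof (rule fundamental_theorem_of_calculus)
    fix x :: real
    have "((\<lambda>z. exp (?a * z) / ?a) has_field_derivative exp (?a * of_real x)) (at (of_real x))"
      using a by (auto intro!: derivative_eq_intros)
    then have "((\<lambda>x. exp (?a * of_real x) / ?a) has_vector_derivative exp (?a * of_real x)) (at x within {0..1})"
      by (rule has_vector_derivative_real_field[THEN has_vector_derivative_at_within])
    then show "((\<lambda>x. exp (?a * of_real x) / ?a) has_vector_derivative ee (of_int h * x)) (at x within {0..1})"
      by (simp add: ee_def cis_conv_exp mult_ac)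
  qed simp
  moreover have "exp (?a * of_real 1) = 1"
    using ee_int[of "of_int h"] by (simp add: ee_def cis_conv_exp mult_ac)
  ultimately have "((\<lambda>x. ee (of_int h * x)) has_integral 0) {0..1}" by simp
  then show ?thesis
    unfolding mean_conv_def using conv by (auto simp: integral_unique has_integral_integrable)
qed

text \<open>A cosine is half the sum of two characters of frequencies 1 and -1, so one more factor
  shifts \<open>h\<close> by 1 either way. The character factor and the arbitrary \<open>h\<close>
  are there for this induction.\<close>

lemma mean_conv_cos_power:
  fixes h :: int
  assumes weyl: "\<And>h::nat. h \<ge> 1 \<Longrightarrow> (\<lambda>J. (\<Sum>j<J. ee (real h * y j)) / of_nat J) \<longlonglongrightarrow> 0"
  shows "mean_conv y (\<lambda>x. complex_of_real (cos (2 * pi * (x - \<theta>))) ^ n * ee (of_int h * x))"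
proof (induction n arbitrary: h)
  case 0
  then show ?case using mean_conv_ee[OF weyl] by simp
next
  case (Suc n)
  let ?c = "\<lambda>x. complex_of_real (cos (2 * pi * (x - \<theta>)))"
  have c: "?c x = (ee (- \<theta>) * ee x + ee \<theta> * ee (- x)) / 2" for x
    by (simp add: complex_eq_iff ee_def cos_add flip: ee_add)
       (simp add: algebra_simps cos_diff cos_add)
  have "(\<lambda>x. ?c x ^ Suc n * ee (of_int h * x))
      = (\<lambda>x. (ee (- \<theta>) / 2) * (?c x ^ n * ee (of_int (h + 1) * x))
          + (ee \<theta> / 2) * (?c x ^ n * ee (of_int (h - 1) * x)))"
  proof
    fix x
    have e1: "ee (of_int (h + 1) * x) = ee (of_int h * x) * ee x"
      by (simp add: algebra_simps flip: ee_add)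
    have e2: "ee (of_int (h - 1) * x) = ee (of_int h * x) * ee (- x)"
      by (simp add: algebra_simps flip: ee_add)
    have "?c x ^ Suc n * ee (of_int h * x) = ?c x * (?c x ^ n * ee (of_int h * x))" by simp
    also have "\<dots> = ((ee (- \<theta>) * ee x + ee \<theta> * ee (- x)) / 2) * (?c x ^ n * ee (of_int h * x))"
      by (simp only: c)
    finally show "?c x ^ Suc n * ee (of_int h * x)
      = (ee (- \<theta>) / 2) * (?c x ^ n * ee (of_int (h + 1) * x))
          + (ee \<theta> / 2) * (?c x ^ n * ee (of_int (h - 1) * x))"
      unfolding e1 e2 by (simp add: field_simps)
  qed
  then show ?case
    by (simp only: mean_conv_add[OF mean_conv_cmult[OF Suc.IH] mean_conv_cmult[OF Suc.IH]])
qed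

text \<open>The averages, the integrals and the convergence for \<open>g\<close> each contribute at
  most r / 4. The approximation is demanded on the whole line because the points \<open>y j\<close>
  may lie anywhere.\<close>

lemma mean_conv_uniform_limit:
  assumes int: "f integrable_on {0..1}"
    and approx: "\<And>e. e > 0 \<Longrightarrow> \<exists>g. mean_conv y g \<and> (\<forall>x. norm (f x - g x) \<le> e)"
  shows "mean_conv y f"
  unfolding mean_conv_def
proof (intro conjI int LIMSEQ_I)
  fix r :: real assume r: "r > 0"
  obtain g where g: "mean_conv y g" "\<And>x. norm (f x - g x) \<le> r / 4"
    using approx[of "r / 4"] r by auto
  obtain J0 where J0: "\<And>J. J \<ge> J0 \<Longrightarrow> norm ((\<Sum>j<J. g (y j)) / of_nat J - integral {0..1} g) < r / 4"
    using g(1) r LIMSEQ_D[of "\<lambda>J. (\<Sum>j<J. g (y j)) / of_nat J" "integral {0..1} g" "r / 4"]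
    by (auto simp: mean_conv_def)
  have "norm ((\<Sum>j<J. f (y j)) / of_nat J - integral {0..1} f) < r" if J: "J \<ge> max J0 1" for J
  proof -
    have J1: "real J > 0" using J by simp
    have "norm ((\<Sum>j<J. f (y j)) / of_nat J - (\<Sum>j<J. g (y j)) / of_nat J)
        = norm (\<Sum>j<J. f (y j) - g (y j)) / real J"
      by (simp add: sum_subtractf norm_divide flip: diff_divide_distrib)
    also have "\<dots> \<le> (\<Sum>j<J. r / 4) / real J"
      using J1 g(2) by (intro divide_right_mono order_trans[OF norm_sum] sum_mono) auto
    also have "\<dots> = r / 4" using J1 by simp
    finally have 1: "norm ((\<Sum>j<J. f (y j)) / of_nat J - (\<Sum>j<J. g (y j)) / of_nat J) \<le> r / 4" .
    have "((\<lambda>x. f x - g x) has_integral (integral {0..1} f - integral {0..1} g)) (cbox 0 1)"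
      using int g(1) by (auto simp: mean_conv_def intro!: has_integral_diff integrable_integral)
    then have 2: "norm (integral {0..1} f - integral {0..1} g) \<le> r / 4"
      using has_integral_bound[of "r / 4" "\<lambda>x. f x - g x" _ 0 "1::real"] g(2) r by simp
    have 3: "norm ((\<Sum>j<J. g (y j)) / of_nat J - integral {0..1} g) < r / 4"
      using J0 J by simp
    have tri: "norm (a - d) \<le> norm (a - b) + norm (b - c) + norm (d - c)" for a b c d :: complex
      using norm_triangle_ineq[of "a - b" "b - c"] norm_triangle_ineq4[of "a - c" "d - c"] by simp
    show ?thesis
      using tri[of "(\<Sum>j<J. f (y j)) / of_nat J" "integral {0..1} f" "(\<Sum>j<J. g (y j)) / of_nat J" "integral {0..1} g"]
        1 2 3 r by linarith
  qed
  then show "\<exists>no. \<forall>n\<ge>no. norm ((\<Sum>j<n. f (y j)) / of_nat n - integral {0..1} f) < r" by blast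
qed

text \<open>Bumps symmetric about \<open>\<theta>\<close> are functions of a single cosine, so
  Weierstrass approximation of \<open>\<psi>\<close> by ordinary polynomials on [-1, 1] reduces them
  to powers of that cosine.\<close>

lemma mean_conv_cont_cos:
  fixes \<psi> :: "real \<Rightarrow> real"
  assumes weyl: "\<And>h::nat. h \<ge> 1 \<Longrightarrow> (\<lambda>J. (\<Sum>j<J. ee (real h * y j)) / of_nat J) \<longlonglongrightarrow> 0"
    and \<psi>: "continuous_on UNIV \<psi>"
  shows "mean_conv y (\<lambda>x. complex_of_real (\<psi> (cos (2 * pi * (x - \<theta>)))))"
proof (rule mean_conv_uniform_limit)
  show "(\<lambda>x. complex_of_real (\<psi> (cos (2 * pi * (x - \<theta>))))) integrable_on {0..1}"
    by (intro integrable_continuous_real continuous_intros continuous_on_compose2[OF \<psi>]) auto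
  fix e :: real assume "e > 0"
  moreover have "continuous_on {-1..1} \<psi>" using \<psi> continuous_on_subset by blast
  ultimately obtain q where q: "real_polynomial_function q" "\<And>x. x \<in> {-1..1} \<Longrightarrow> \<bar>\<psi> x - q x\<bar> < e"
    using Stone_Weierstrass_real_polynomial_function[of "{-1..1}" \<psi> e] by auto
  obtain a n where q_eq: "q = (\<lambda>x. \<Sum>i\<le>n. a i * x ^ i)"
    using q(1) real_polynomial_function_iff_sum by blast
  let ?g = "\<lambda>x. complex_of_real (q (cos (2 * pi * (x - \<theta>))))"
  have "mean_conv y (\<lambda>x. \<Sum>i\<le>n. complex_of_real (a i) *
      (complex_of_real (cos (2 * pi * (x - \<theta>))) ^ i * ee (of_int 0 * x)))"
    by (intro mean_conv_sum mean_conv_cmult mean_conv_cos_power[OF weyl]) auto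
  then have "mean_conv y ?g" by (simp add: q_eq)
  moreover have "norm (complex_of_real (\<psi> (cos (2 * pi * (x - \<theta>)))) - ?g x) \<le> e" for x
    using q(2)[of "cos (2 * pi * (x - \<theta>))"] by (simp add: norm_of_real less_imp_le flip: of_real_diff)
  ultimately show "\<exists>g. mean_conv y g \<and>
      (\<forall>x. norm (complex_of_real (\<psi> (cos (2 * pi * (x - \<theta>)))) - g x) \<le> e)"
    by blast
qed

text \<open>A large cosine places \<open>z\<close> within \<open>r\<close> of an integer, and
  \<open>\<bar>z\<bar> \<le> 1 - r\<close> excludes the integers 1 and -1.\<close>

lemma abs_less_if_cos_greater:
  assumes "0 \<le> r" "r \<le> 1 / 2" "\<bar>z\<bar> \<le> 1 - r" "cos (2 * pi * z) > cos (2 * pi * r)"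
  shows "\<bar>z\<bar> < r"
proof (rule ccontr)
  assume "\<not> \<bar>z\<bar> < r"
  then have z: "r \<le> \<bar>z\<bar>" by simp
  have "cos (2 * pi * \<bar>z\<bar>) \<le> cos (2 * pi * r)"
  proof (cases "\<bar>z\<bar> \<le> 1 / 2")
    case True
    then show ?thesis using z assms
      by (intro cos_monotone_0_pi_le) (auto simp: field_simps)
  next
    case False
    have "cos (2 * pi * \<bar>z\<bar>) = cos (2 * pi - 2 * pi * \<bar>z\<bar>)" by (simp add: cos_diff)
    also have "\<dots> = cos (2 * pi * (1 - \<bar>z\<bar>))" by (simp add: algebra_simps)
    also have "\<dots> \<le> cos (2 * pi * r)"
    proof (rule cos_monotone_0_pi_le)
      show "2 * pi * r \<le> 2 * pi * (1 - \<bar>z\<bar>)" using assms by (intro mult_left_mono) auto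
      have "2 * pi * (1 - \<bar>z\<bar>) \<le> 2 * pi * (1 / 2)" using False by (intro mult_left_mono) auto
      then show "2 * pi * (1 - \<bar>z\<bar>) \<le> pi" by simp
    qed (use assms in simp)
    finally show ?thesis .
  qed
  moreover have "cos (2 * pi * \<bar>z\<bar>) = cos (2 * pi * z)" by (cases "z \<ge> 0") auto
  ultimately show False using assms by simp
qed

section \<open>Frequencies of visits to intervals\<close>

definition hits :: "(nat \<Rightarrow> real) \<Rightarrow> real \<Rightarrow> real \<Rightarrow> nat \<Rightarrow> nat" where
  "hits y s t J = card {j. j < J \<and> frac (y j) \<in> {s..<t}}"

text \<open>A continuous bump below the periodic indicator of the interval, with integral greater
  than \<open>t - s - e\<close>, bounds the count from below.\<close>

lemma hits_lower_bound:
  assumes weyl: "\<And>h::nat. h \<ge> 1 \<Longrightarrow> (\<lambda>J. (\<Sum>j<J. ee (real h * y j)) / of_nat J) \<longlonglongrightarrow> 0"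
    and st: "0 \<le> s" "s \<le> t" "t \<le> 1" and e: "e > 0"
  shows "\<forall>\<^sub>F J in sequentially. real (hits y s t J) / real J \<ge> t - s - e"
proof (cases "t - s \<le> e")
  case True
  have "t - s - e \<le> real (hits y s t J) / real J" for J
  proof -
    have "0 \<le> real (hits y s t J) / real J" by simp
    with True show ?thesis by linarith
  qed
  then show ?thesis by simp
next
  case False
  define \<theta> where "\<theta> = (s + t) / 2"
  define r where "r = (t - s) / 2"
  \<comment> \<open>The bump equals 1 within \<open>r'\<close> of the midpoint
    \<open>\<theta>\<close> and vanishes beyond \<open>r\<close>, up to period 1. Its plateau has
    length \<open>t - s - e / 2\<close>.\<close>
  define r' where "r' = (t - s) / 2 - e / 4"
  have rr: "0 < r'" "r' < r" "r \<le> 1 / 2" "r \<ge> 0"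
  proof -
    have st_gt: "t - s > e" using False by simp
    show "r' < r" using e by (simp only: r_def r'_def)
    show "0 < r'" "r \<le> 1 / 2" "r \<ge> 0" using st_gt e st by (auto simp: r_def r'_def)
  qed
  define a where "a = cos (2 * pi * r)"
  define a' where "a' = cos (2 * pi * r')"
  have aa: "a < a'"
    unfolding a_def a'_def using rr by (intro cos_monotone_0_pi) (auto simp: field_simps)
  define \<psi> where "\<psi> = (\<lambda>u. min 1 (max 0 ((u - a) / (a' - a))))"
  define f where "f = (\<lambda>x. \<psi> (cos (2 * pi * (x - \<theta>))))"
  have \<psi>01: "0 \<le> \<psi> u" "\<psi> u \<le> 1" for u by (auto simp: \<psi>_def)
  have cont: "continuous_on UNIV \<psi>" unfolding \<psi>_def using aa by (intro continuous_intros) auto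
  have mc: "mean_conv y (\<lambda>x. complex_of_real (f x))"
    unfolding f_def by (rule mean_conv_cont_cos[OF weyl cont])
  have contf: "continuous_on A f" for A
    unfolding f_def by (intro continuous_on_compose2[OF cont] continuous_intros) auto
  have "integral {0..1} (\<lambda>x. complex_of_real (f x)) = of_real (integral {0..1} f)"
    using integral_linear[OF integrable_continuous_real[OF contf[of "{0..1}"]] bounded_linear_of_real]
    by (simp add: o_def)
  moreover have "(\<Sum>j<J. complex_of_real (f (y j))) / of_nat J = of_real ((\<Sum>j<J. f (y j)) / real J)" for J
    by simp
  ultimately have "(\<lambda>J. complex_of_real ((\<Sum>j<J. f (y j)) / real J)) \<longlonglongrightarrow> of_real (integral {0..1} f)"
    using mc unfolding mean_conv_def by simp
  then have lim: "(\<lambda>J. (\<Sum>j<J. f (y j)) / real J) \<longlonglongrightarrow> integral {0..1} f"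
    by (simp only: tendsto_of_real_iff)
  have sub: "{\<theta> - r'..\<theta> + r'} \<subseteq> {0..1}" using rr st by (auto simp: \<theta>_def r'_def r_def field_simps)
  have "2 * r' = integral {\<theta> - r'..\<theta> + r'} (\<lambda>x. 1)" using rr by simp
  also have "\<dots> \<le> integral {\<theta> - r'..\<theta> + r'} f"
  proof (rule integral_le)
    fix x assume "x \<in> {\<theta> - r'..\<theta> + r'}"
    then have x: "\<bar>x - \<theta>\<bar> \<le> r'" by auto
    have "a' \<le> cos (2 * pi * \<bar>x - \<theta>\<bar>)"
      unfolding a'_def using x rr by (intro cos_monotone_0_pi_le) (auto simp: field_simps)
    moreover have "cos (2 * pi * \<bar>x - \<theta>\<bar>) = cos (2 * pi * (x - \<theta>))"
      by (metis abs_mult abs_numeral abs_of_nonneg cos_abs_real pi_ge_zero)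
    ultimately show "1 \<le> f x" using aa by (simp add: f_def \<psi>_def)
  qed (auto intro!: integrable_continuous_real contf)
  also have "\<dots> \<le> integral {0..1} f"
    using sub \<psi>01 by (intro integral_subset_le integrable_continuous_real contf) (auto simp: f_def)
  finally have ge: "2 * r' \<le> integral {0..1} f" .
  have "t - s - e < integral {0..1} f"
  proof -
    have "2 * r' = t - s - e / 2" by (simp add: r'_def diff_divide_distrib)
    then show ?thesis using ge e by linarith
  qed
  then have "\<forall>\<^sub>F J in sequentially. t - s - e < (\<Sum>j<J. f (y j)) / real J"
    using lim by (rule order_tendstoD(1)[rotated])
  then show ?thesis
  proof eventually_elim
    case (elim J)
    have le: "f (y j) \<le> (if frac (y j) \<in> {s..<t} then 1 else 0)" for j
    proof (cases "frac (y j) \<in> {s..<t}")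
      case False
      define x where "x = frac (y j)"
      have x: "0 \<le> x" "x < 1" by (auto simp: x_def frac_lt_1)
      have "y j = x + of_int \<lfloor>y j\<rfloor>" by (simp add: x_def frac_def)
      then obtain n :: int where n: "y j = x + of_int n" by blast
      have "cos (2 * pi * (y j - \<theta>)) = cos (2 * pi * (x - \<theta>) + 2 * pi * of_int n)"
        by (simp add: n algebra_simps)
      also have "\<dots> = cos (2 * pi * (x - \<theta>))"
        by (simp add: cos_add)
      finally have c: "cos (2 * pi * (y j - \<theta>)) = cos (2 * pi * (x - \<theta>))" .
      have "\<not> cos (2 * pi * (x - \<theta>)) > cos (2 * pi * r)"
      proof
        assume "cos (2 * pi * (x - \<theta>)) > cos (2 * pi * r)"
        moreover have "\<bar>x - \<theta>\<bar> \<le> 1 - r" using x st by (auto simp: \<theta>_def r_def field_simps)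
        ultimately have "\<bar>x - \<theta>\<bar> < r" using rr by (intro abs_less_if_cos_greater) auto
        then have "x \<in> {s..<t}" by (auto simp: \<theta>_def r_def field_simps)
        then show False using False by (simp add: x_def)
      qed
      then have "(cos (2 * pi * (y j - \<theta>)) - a) / (a' - a) \<le> 0"
        using aa unfolding c a_def by (auto intro: divide_nonpos_pos)
      then show ?thesis using False by (simp add: f_def \<psi>_def)
    qed (use \<psi>01 in \<open>auto simp: f_def\<close>)
    have "(\<Sum>j<J. f (y j)) \<le> (\<Sum>j<J. if frac (y j) \<in> {s..<t} then 1 else 0)"
      by (intro sum_mono le)
    also have "\<dots> = real (hits y s t J)"
      unfolding hits_def by (simp add: sum.If_cases Collect_conj_eq lessThan_def)
    finally have "(\<Sum>j<J. f (y j)) / real J \<le> real (hits y s t J) / real J"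
      by (intro divide_right_mono) auto
    with elim show ?case by linarith
  qed
qed

text \<open>Lower bounds suffice: the three intervals partition [0, 1), so those for the outer two
  give the upper bound for the middle one.\<close>

lemma hits_tendsto:
  assumes weyl: "\<And>h::nat. h \<ge> 1 \<Longrightarrow> (\<lambda>J. (\<Sum>j<J. ee (real h * y j)) / of_nat J) \<longlonglongrightarrow> 0"
    and st: "0 \<le> s" "s \<le> t" "t \<le> 1"
  shows "(\<lambda>J. real (hits y s t J) / real J) \<longlonglongrightarrow> t - s"
proof (rule tendstoI)
  fix e :: real assume e: "e > 0"
  have partition: "hits y 0 s J + hits y s t J + hits y t 1 J = J" for J
  proof -
    have fr: "0 \<le> frac x" "frac x < 1" for x :: real by (auto simp: frac_lt_1)
    let ?A = "\<lambda>s t. {j. j < J \<and> frac (y j) \<in> {s..<t}}"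
    have "card (?A 0 s \<union> ?A s t \<union> ?A t 1) = card (?A 0 s) + card (?A s t) + card (?A t 1)"
      using st by (subst card_Un_disjoint, simp, simp, force, subst card_Un_disjoint) force+
    moreover have "?A 0 s \<union> ?A s t \<union> ?A t 1 = {..<J}" using fr st by (auto simp: not_le)
    ultimately show ?thesis by (simp add: hits_def)
  qed
  have "\<forall>\<^sub>F J in sequentially. real (hits y 0 s J) / real J \<ge> s - 0 - e / 3"
    "\<forall>\<^sub>F J in sequentially. real (hits y s t J) / real J \<ge> t - s - e / 3"
    "\<forall>\<^sub>F J in sequentially. real (hits y t 1 J) / real J \<ge> 1 - t - e / 3"
    using hits_lower_bound[OF weyl, where e = "e / 3"] st e by fastforce+
  then show "\<forall>\<^sub>F J in sequentially. dist (real (hits y s t J) / real J) (t - s) < e"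
    using eventually_gt_at_top[of 0]
  proof eventually_elim
    case (elim J)
    have "real (hits y 0 s J) / real J + real (hits y s t J) / real J + real (hits y t 1 J) / real J
        = real (hits y 0 s J + hits y s t J + hits y t 1 J) / real J"
      by (simp add: add_divide_distrib)
    also have "\<dots> = 1" using elim unfolding partition by simp
    finally show ?case using elim e unfolding dist_real_def by linarith
  qed
qed

section \<open>Digit words as intervals, and Weyl's criterion\<close>

text \<open>The number 0.w in base \<open>b\<close>, the left end of the interval of points whose
  expansion begins with \<open>w\<close>.\<close>

fun word_point :: "nat \<Rightarrow> nat list \<Rightarrow> real" where
  "word_point b [] = 0"
| "word_point b (d # w) = (real d + word_point b w) / real b"

lemma word_point_bounds:
  assumes "b \<ge> 2" "set w \<subseteq> {..<b}"
  shows "0 \<le> word_point b w \<and> word_point b w + 1 / real b ^ length w \<le> 1"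
  using assms(2)
proof (induction w)
  case (Cons d w)
  then have IH: "0 \<le> word_point b w" "word_point b w + 1 / real b ^ length w \<le> 1"
    and d: "real d + 1 \<le> real b" by auto
  have "word_point b (d # w) + 1 / real b ^ length (d # w)
      = (real d + (word_point b w + 1 / real b ^ length w)) / real b"
    using assms(1) by (simp add: field_simps)
  also have "\<dots> \<le> real b / real b" using IH d by (intro divide_right_mono) auto
  finally show ?case using IH assms(1) by simp
qed simp

lemma base_digit_add_int:
  "base_digit b (x + of_int z) i = base_digit b x i"
proof -
  have "(x + of_int z) * real b ^ Suc i = x * real b ^ Suc i + of_int (z * int b ^ Suc i)"
    by (simp add: algebra_simps)
  then have "\<lfloor>(x + of_int z) * real b ^ Suc i\<rfloor> = \<lfloor>x * real b ^ Suc i\<rfloor> + z * int b ^ Suc i"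
    by (simp only: floor_add_int)
  also have "z * int b ^ Suc i = (z * int b ^ i) * int b" by simp
  finally show ?thesis unfolding base_digit_def by (simp only: mod_mult_self1)
qed

lemma base_digit_shift: "base_digit b x (i + k) = base_digit b (x * real b ^ i) k"
  by (simp add: base_digit_def power_add mult_ac)

text \<open>Induction on the word: multiplication by \<open>b\<close> moves the first digit into the
  integer part and leaves the remaining digits to the fractional part \<open>y\<close>.\<close>

lemma base_digits_eq_word_iff:
  assumes b: "b \<ge> 2" and w: "set w \<subseteq> {..<b}" and x: "0 \<le> x" "x < 1"
  shows "(\<forall>k<length w. base_digit b x k = w ! k)
    \<longleftrightarrow> x \<in> {word_point b w..<word_point b w + 1 / real b ^ length w}"
  using w x
proof (induction w arbitrary: x)
  case (Cons d w)
  have d: "d < b" using Cons.prems by auto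
  have b0: "real b > 0" using b by simp
  define n where "n = \<lfloor>x * real b\<rfloor>"
  define y where "y = x * real b - of_int n"
  have y: "0 \<le> y" "y < 1" unfolding y_def n_def by linarith+
  have n: "0 \<le> n" "n < int b"
  proof -
    show "0 \<le> n" unfolding n_def using Cons.prems b by simp
    have "x * real b < 1 * real b" using Cons.prems b0 by (intro mult_strict_right_mono) auto
    then show "n < int b" unfolding n_def by linarith
  qed
  have digit0: "base_digit b x 0 = nat n" using n by (simp add: base_digit_def n_def)
  have digits: "base_digit b x (Suc k) = base_digit b y k" for k
    using base_digit_shift[of b x 1 k] base_digit_add_int[of b y n k] by (simp add: y_def)
  have bounds: "0 \<le> word_point b w" "word_point b w + 1 / real b ^ length w \<le> 1"
    using word_point_bounds[OF b, of w] Cons.prems by auto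
  have "(\<forall>k<length (d # w). base_digit b x k = (d # w) ! k)
      \<longleftrightarrow> nat n = d \<and> (\<forall>k<length w. base_digit b y k = w ! k)"
    by (simp add: All_less_Suc2 digit0 digits)
  also have "\<dots> \<longleftrightarrow> n = int d \<and> y \<in> {word_point b w..<word_point b w + 1 / real b ^ length w}"
    using Cons.IH[of y] Cons.prems y n by auto
  also have "\<dots> \<longleftrightarrow> x * real b \<in> {real d + word_point b w..<real d + word_point b w + 1 / real b ^ length w}"
  proof
    assume "x * real b \<in> {real d + word_point b w..<real d + word_point b w + 1 / real b ^ length w}"
    moreover from this have "n = int d"
      using bounds unfolding n_def by (intro floor_unique) auto
    ultimately show "n = int d \<and> y \<in> {word_point b w..<word_point b w + 1 / real b ^ length w}"
      by (auto simp: y_def)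
  qed (auto simp: y_def)
  also have "\<dots> \<longleftrightarrow> x \<in> {word_point b (d # w)..<word_point b (d # w) + 1 / real b ^ length (d # w)}"
  proof -
    have "word_point b (d # w) + 1 / real b ^ length (d # w)
        = (real d + word_point b w + 1 / real b ^ length w) / real b"
      by (simp add: add_divide_distrib)
    then show ?thesis
      using b0 by (simp add: pos_less_divide_eq pos_divide_le_eq del: length_Cons)
  qed
  finally show ?case .
qed simp

text \<open>A word of length \<open>m\<close> occurs at position \<open>i\<close> exactly when the
  fractional part of \<open>real b ^ i * \<alpha>\<close> lies in an interval of length
  \<open>1 / real b ^ m\<close>.\<close>

lemma normal_to_base_weyl:
  assumes b: "b \<ge> 2" and \<alpha>: "0 \<le> \<alpha>" "\<alpha> < 1"
    and weyl: "\<And>h::nat. h \<ge> 1 \<Longrightarrow> (\<lambda>J. (\<Sum>j<J. ee (real h * (real b ^ j * \<alpha>))) / of_nat J) \<longlonglongrightarrow> 0"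
  shows "normal_to_base b \<alpha>"
  unfolding normal_to_base_def
proof (intro conjI allI impI)
  show "b \<ge> 2" "\<alpha> \<in> {0..<1}" using b \<alpha> by auto
  fix m w assume m: "m \<ge> 1" and "length w = m \<and> set w \<subseteq> {..<b}"
  then have w: "length w = m" "set w \<subseteq> {..<b}" by auto
  define y where "y = (\<lambda>j. real b ^ j * \<alpha>)"
  define s where "s = word_point b w"
  define t where "t = s + 1 / real b ^ m"
  have st: "0 \<le> s" "s \<le> t" "t \<le> 1"
    using word_point_bounds[OF b w(2)] w(1) by (auto simp: s_def t_def)
  have lim: "(\<lambda>J. real (hits y s t J) / real J) \<longlonglongrightarrow> t - s"
    using weyl by (intro hits_tendsto st) (auto simp: y_def)
  have digits: "(\<forall>k<length w. base_digit b \<alpha> (i + k) = w ! k) \<longleftrightarrow> frac (y i) \<in> {s..<t}" for i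
  proof -
    have "base_digit b \<alpha> (i + k) = base_digit b (frac (y i)) k" for k
      using base_digit_add_int[of b "frac (y i)" "\<lfloor>y i\<rfloor>" k]
      by (simp add: base_digit_shift y_def mult.commute frac_def)
    then show ?thesis
      using base_digits_eq_word_iff[OF b w(2), of "frac (y i)"] w(1) by (simp add: s_def t_def frac_lt_1)
  qed
  \<comment> \<open>A prefix of \<open>J + m\<close> digits has \<open>Suc J\<close> starting
    positions for a word of length \<open>m\<close>; the ratio of these two counts tends to
    1.\<close>
  have occ: "card (occurrences b \<alpha> w (J + m)) = hits y s t (Suc J)" for J
    unfolding occurrences_def hits_def digits[unfolded w(1)] w(1) by (rule arg_cong[of _ _ card]) auto
  have "(\<lambda>J. real (hits y s t (Suc J)) / real (Suc J)) \<longlonglongrightarrow> t - s"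
    using lim by (rule LIMSEQ_Suc)
  moreover have "(\<lambda>J. real (Suc J) / real (J + m)) \<longlonglongrightarrow> 1"
    using m by real_asymp
  ultimately have "(\<lambda>J. real (hits y s t (Suc J)) / real (Suc J) * (real (Suc J) / real (J + m))) \<longlonglongrightarrow> (t - s) * 1"
    by (rule tendsto_mult)
  then have "(\<lambda>J. real (card (occurrences b \<alpha> w (J + m))) / real (J + m)) \<longlonglongrightarrow> 1 / real b ^ m"
    by (simp add: occ t_def)
  then show "(\<lambda>j. real (card (occurrences b \<alpha> w j)) / real j) \<longlonglongrightarrow> 1 / real b ^ m"
    by (rule LIMSEQ_offset)
qed

section \<open>Construction of the number\<close>

definition weyl_sum :: "nat \<Rightarrow> nat \<Rightarrow> real \<Rightarrow> nat \<Rightarrow> complex" where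
  "weyl_sum b h x J = (\<Sum>j<J. ee (real h * real b ^ j * x))"

lemma norm_weyl_sum_le: "norm (weyl_sum b h x J) \<le> real J"
  unfolding weyl_sum_def using sum_norm_bound[of "{..<J}" "\<lambda>j. ee (real h * real b ^ j * x)" 1] by simp

lemma weyl_sum_split:
  "weyl_sum b h x (L + J) = weyl_sum b h x L + (\<Sum>j<J. ee (real h * real b ^ (L + j) * x))"
  unfolding weyl_sum_def by (induction J) auto

text \<open>The difference of the terms at \<open>j\<close> is at most
  \<open>2 * pi * real h * real b ^ j * \<bar>x - y\<bar>\<close>, and for \<open>b \<ge> 2\<close>
  the powers below \<open>J\<close> add up to at most \<open>real b ^ J\<close>.\<close>

lemma weyl_sum_close:
  assumes "b \<ge> 2"
  shows "norm (weyl_sum b h x J - weyl_sum b h y J) \<le> 2 * pi * real h * (real b ^ J * \<bar>x - y\<bar>)"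
proof (induction J)
  case (Suc J)
  have "norm (weyl_sum b h x (Suc J) - weyl_sum b h y (Suc J))
      = norm ((weyl_sum b h x J - weyl_sum b h y J)
          + (ee (real h * real b ^ J * x) - ee (real h * real b ^ J * y)))"
    by (simp add: weyl_sum_def algebra_simps)
  also have "\<dots> \<le> 2 * pi * real h * (real b ^ J * \<bar>x - y\<bar>)
      + 2 * pi * \<bar>real h * real b ^ J * x - real h * real b ^ J * y\<bar>"
    by (intro norm_triangle_le add_mono Suc.IH norm_ee_diff_le)
  also have "\<bar>real h * real b ^ J * x - real h * real b ^ J * y\<bar> = real h * real b ^ J * \<bar>x - y\<bar>"
    by (simp add: abs_mult flip: right_diff_distrib)
  also have "2 * pi * real h * (real b ^ J * \<bar>x - y\<bar>) + 2 * pi * (real h * real b ^ J * \<bar>x - y\<bar>)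
      = 2 * (2 * pi * real h * (real b ^ J * \<bar>x - y\<bar>))" by simp
  also have "\<dots> \<le> real b * (2 * pi * real h * (real b ^ J * \<bar>x - y\<bar>))"
    using assms by (intro mult_right_mono) auto
  also have "\<dots> = 2 * pi * real h * (real b ^ Suc J * \<bar>x - y\<bar>)" by simp
  finally show ?case .
qed (simp add: weyl_sum_def)

text \<open>Numbers at distance less than \<open>d\<close> can have diverging expansions only from
  about the first \<open>J\<close> with \<open>real b ^ J * d \<ge> 1\<close>. A small gap pushes
  this position past any bound, in all bases at once.\<close>

lemma small_gap_forces_large_index:
  fixes B :: "nat set" and M :: real
  assumes "finite B"
  shows "\<exists>D>0. \<forall>d. d \<le> D \<longrightarrow> (\<forall>b\<in>B. \<forall>J. real b ^ J * d \<ge> 1 \<longrightarrow> M \<le> real J)"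
proof -
  define m where "m = nat \<lceil>M\<rceil>"
  define c where "c = (\<Sum>b\<in>B. b) + 1"
  define D where "D = 1 / (real c ^ m + 1)"
  have "M \<le> real J" if d: "d \<le> D" and b: "b \<in> B" "real b ^ J * d \<ge> 1" for d b J
  proof (rule ccontr)
    assume "\<not> M \<le> real J"
    then have "J < m" unfolding m_def by linarith
    have "b \<le> (\<Sum>b\<in>B. b)" using assms b by (intro member_le_sum) auto
    then have "b \<le> c" by (simp add: c_def)
    then have "real b ^ J \<le> real c ^ J" by (intro power_mono) auto
    also have "\<dots> \<le> real c ^ m" using \<open>J < m\<close> by (intro power_increasing) (auto simp: c_def intro: sum_nonneg)
    finally have bc: "real b ^ J \<le> real c ^ m" .
    have pos: "real c ^ m + 1 > 0" by (intro add_nonneg_pos) auto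
    have "real b ^ J * d \<le> real b ^ J * D" using d by (intro mult_left_mono) auto
    also have "\<dots> \<le> real c ^ m * D" using bc pos by (intro mult_right_mono) (auto simp: D_def)
    also have "\<dots> < 1" using pos by (simp add: D_def)
    finally show False using b by simp
  qed
  moreover have "D > 0" unfolding D_def by (intro divide_pos_pos add_nonneg_pos) auto
  ultimately show ?thesis by blast
qed

section \<open>The nested intervals and their common point\<close>

text \<open>Dependent choice produces pairs of a fraction and a gap with nested intervals. The gaps
  give the Liouville property; control of every new fraction from the departure position onwards
  leaves no range of lengths without a bound, whence normality.\<close>

lemma exists_liouville_normal:
  fixes B P :: "nat set"
  assumes B: "finite B" "\<And>b. b \<in> B \<Longrightarrow> b \<ge> 2"
    and P: "infinite P" "\<And>p. p \<in> P \<Longrightarrow> prime p" "\<And>p b. p \<in> P \<Longrightarrow> b \<in> B \<Longrightarrow> residue_primroot p b"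
  shows "\<exists>\<alpha>. liouville_number \<alpha> \<and> (\<forall>b\<in>B. normal_to_base b \<alpha>)"
proof -
  define \<epsilon> :: "nat \<Rightarrow> real" where "\<epsilon> = (\<lambda>k. 1 / real (Suc k))"
  have \<epsilon>: "\<epsilon> k > 0" "\<epsilon> (Suc k) \<le> \<epsilon> k" for k by (auto simp: \<epsilon>_def field_simps)
  have "\<exists>T. \<forall>k. T k \<ge> 0 \<and> (\<forall>u \<delta> L. u \<ge> 0 \<longrightarrow> \<delta> > 0 \<longrightarrow> u + \<delta> \<le> 1 \<longrightarrow> (\<forall>b\<in>B. real b ^ L b * \<delta> \<ge> 1) \<longrightarrow>
    (\<exists>p c :: nat. p > 1 \<and> u < real c / real p \<and> real c / real p < u + \<delta> \<and>
      (\<forall>b\<in>B. \<forall>h\<in>{1..k}. \<forall>J.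
        norm (\<Sum>j<J. ee (real h * real b ^ (L b + j) * (real c / real p))) \<le> \<epsilon> k * real J + T k)))"
    by (intro choice allI) (use uniform_good_fraction[OF B P \<epsilon>(1)] in blast)
  then obtain T :: "nat \<Rightarrow> real" where T: "\<And>k. T k \<ge> 0"
    and fraction: "\<And>k u \<delta> L. u \<ge> 0 \<Longrightarrow> \<delta> > 0 \<Longrightarrow> u + \<delta> \<le> 1 \<Longrightarrow> \<forall>b\<in>B. real b ^ L b * \<delta> \<ge> 1 \<Longrightarrow>
    \<exists>p c :: nat. p > 1 \<and> u < real c / real p \<and> real c / real p < u + \<delta> \<and>
      (\<forall>b\<in>B. \<forall>h\<in>{1..k}. \<forall>J.
        norm (\<Sum>j<J. ee (real h * real b ^ (L b + j) * (real c / real p))) \<le> \<epsilon> k * real J + T k)"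
    by blast
  \<comment> \<open>In \<open>R k (x, d)\<close> the gap \<open>d\<close> is so small that wherever a number in \<open>(x, x + d)\<close> may depart from \<open>x\<close>,
    all additive constants, including the one of the next fraction, are absorbed by \<open>\<epsilon> k * J\<close>.\<close>
  define R where "R = (\<lambda>k (x, d). d > 0 \<and> 0 < x \<and> x + d < 1 \<and>
    (\<exists>p c :: nat. p > 1 \<and> x = real c / real p \<and> d < 1 / real p ^ k) \<and>
    (\<exists>K. (\<forall>b\<in>B. \<forall>h\<in>{1..k}. \<forall>J. norm (weyl_sum b h x J) \<le> \<epsilon> k * real J + K) \<and>
      (\<forall>b\<in>B. \<forall>h\<in>{1..k}. \<forall>J. real b ^ J * d \<ge> 1 \<longrightarrow>
        K + 2 * pi * real h * real b + T (Suc k) \<le> \<epsilon> k * real J)))"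
  \<comment> \<open>\<open>Q\<close> passes to \<open>x'\<close> a bound without additive constant,
    valid for all lengths at which the old gap is already visible.\<close>
  define Q where "Q = (\<lambda>k (x, d) (x', d'). x < x' \<and> x' + d' < x + d \<and>
    (\<forall>b\<in>B. \<forall>h\<in>{1..k}. \<forall>J. real b ^ J * d \<ge> 1 \<longrightarrow> norm (weyl_sum b h x' J) \<le> 2 * \<epsilon> k * real J))"
  have choose_gap: "\<exists>d. R k (x, d) \<and> x + d < r"
    if x: "0 < x" "x < r" "r \<le> 1" and pc: "p > 1" "x = real c / real p"
      and K: "\<forall>b\<in>B. \<forall>h\<in>{1..k}. \<forall>J. norm (weyl_sum b h x J) \<le> \<epsilon> k * real J + K"
    for k x r K and p c :: nat
  proof -
    \<comment> \<open>Lengths of at least \<open>M\<close> absorb the constants; \<open>k\<close>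
      dominates every \<open>h\<close>, and \<open>\<Sum>B\<close> every base.\<close>
    define M where "M = (K + 2 * pi * real k * real (\<Sum>B) + T (Suc k)) / \<epsilon> k"
    obtain D where D: "D > 0" "\<And>d b J. d \<le> D \<Longrightarrow> b \<in> B \<Longrightarrow> real b ^ J * d \<ge> 1 \<Longrightarrow> M \<le> real J"
      using small_gap_forces_large_index[OF B(1), of M] by blast
    define q where "q = 1 / real p ^ k"
    \<comment> \<open>The three entries absorb the constants, keep the new interval below
      \<open>r\<close>, and secure the Liouville inequality at exponent \<open>k\<close>.\<close>
    define d where "d = min D (min ((r - x) / 2) (q / 2))"
    have d: "d > 0" "x + d < r" "d \<le> D" "d < 1 / real p ^ k"
    proof -
      have q: "q > 0" using pc by (simp add: q_def)
      then show "d > 0" using D(1) x by (simp add: d_def)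
      show "d \<le> D" by (simp add: d_def)
      have "d \<le> (r - x) / 2" unfolding d_def by linarith
      then have "2 * d \<le> r - x" by simp
      then show "x + d < r" using x \<open>d > 0\<close> by linarith
      have "d \<le> q / 2" unfolding d_def by linarith
      then have "d < q" using q by linarith
      then show "d < 1 / real p ^ k" by (simp only: q_def)
    qed
    have "K + 2 * pi * real h * real b + T (Suc k) \<le> \<epsilon> k * real J"
      if "b \<in> B" "h \<in> {1..k}" "real b ^ J * d \<ge> 1" for b h J
    proof -
      have "b \<le> \<Sum>B" using B(1) that by (intro member_le_sum) auto
      then have "2 * pi * real h * real b \<le> 2 * pi * real k * real (\<Sum>B)"
        using that by (intro mult_mono of_nat_mono) (auto simp del: of_nat_sum)
      moreover have "M \<le> real J" using D(2) d that by blast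
      then have "K + 2 * pi * real k * real (\<Sum>B) + T (Suc k) \<le> \<epsilon> k * real J"
        using \<epsilon>(1)[of k] unfolding M_def by (simp add: pos_divide_le_eq mult.commute)
      ultimately show ?thesis by linarith
    qed
    then have "\<forall>b\<in>B. \<forall>h\<in>{1..k}. \<forall>J. real b ^ J * d \<ge> 1 \<longrightarrow>
        K + 2 * pi * real h * real b + T (Suc k) \<le> \<epsilon> k * real J"
      by blast
    moreover have "x + d < 1" using d x by linarith
    ultimately have "R k (x, d)"
      unfolding R_def prod.case using x(1) d(1,4) pc K by blast
    then show ?thesis using d by blast
  qed
  have base: "\<exists>y. R 0 y"
  proof -
    have "\<forall>b\<in>B. real b ^ 1 * (1 / 2) \<ge> 1" using B(2) by auto
    then obtain p c :: nat where "p > 1" "0 < real c / real p" "real c / real p < 0 + 1 / 2"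
      using fraction[of 0 "1 / 2" "\<lambda>_. 1" 0] by auto
    then show ?thesis using choose_gap[of "real c / real p" 1 p c 0 0] by auto
  qed
  have step: "\<exists>y'. R (Suc k) y' \<and> Q k y y'" if Ry: "R k y" for k y
  proof -
    obtain x d where y: "y = (x, d)" by force
    have d: "d > 0" "0 < x" "x + d < 1" using Ry unfolding R_def y by auto
    obtain K where "\<forall>b\<in>B. \<forall>h\<in>{1..k}. \<forall>J. norm (weyl_sum b h x J) \<le> \<epsilon> k * real J + K"
      and "\<forall>b\<in>B. \<forall>h\<in>{1..k}. \<forall>J. real b ^ J * d \<ge> 1 \<longrightarrow>
        K + 2 * pi * real h * real b + T (Suc k) \<le> \<epsilon> k * real J"
      using Ry unfolding R_def y prod.case by blast
    then have K: "\<And>b h J. b \<in> B \<Longrightarrow> h \<in> {1..k} \<Longrightarrow> norm (weyl_sum b h x J) \<le> \<epsilon> k * real J + K"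
      and gap: "\<And>b h J. b \<in> B \<Longrightarrow> h \<in> {1..k} \<Longrightarrow> real b ^ J * d \<ge> 1 \<Longrightarrow>
        K + 2 * pi * real h * real b + T (Suc k) \<le> \<epsilon> k * real J"
      by blast+
    \<comment> \<open>The departure position. Its minimality gives
      \<open>real b ^ L b * d \<le> real b\<close>, so up to there the sums of \<open>x\<close> and
      the new fraction differ by at most \<open>2 * pi * real h * real b\<close>, the term provided
      for in \<open>R\<close>.\<close>
    define L where "L = (\<lambda>b. LEAST J. real b ^ J * d \<ge> 1)"
    have L: "real b ^ L b * d \<ge> 1" "real b ^ L b * d \<le> real b" if b: "b \<in> B" for b
    proof -
      have b2: "real b \<ge> 2" using B(2)[OF b] by simp
      then obtain J where "1 / d < real b ^ J" using real_arch_pow[of "real b" "1 / d"] by auto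
      then have "real b ^ J * d \<ge> 1" using d by (simp add: field_simps)
      then show ge: "real b ^ L b * d \<ge> 1" unfolding L_def by (rule LeastI)
      have "L b \<noteq> 0"
      proof
        assume "L b = 0"
        then show False using ge d by simp
      qed
      then obtain J where J: "L b = Suc J" using not0_implies_Suc by blast
      then have "\<not> real b ^ J * d \<ge> 1"
        using not_less_Least[of J "\<lambda>J. real b ^ J * d \<ge> 1"] unfolding L_def by simp
      then have "real b * (real b ^ J * d) \<le> real b * 1" using b2 by (intro mult_left_mono) auto
      then show "real b ^ L b * d \<le> real b" using J by (simp add: mult.assoc)
    qed
    obtain p c :: nat where p: "p > 1" and c: "x < real c / real p" "real c / real p < x + d"
      and tail: "\<forall>b\<in>B. \<forall>h\<in>{1..Suc k}. \<forall>J.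
        norm (\<Sum>j<J. ee (real h * real b ^ (L b + j) * (real c / real p))) \<le> \<epsilon> (Suc k) * real J + T (Suc k)"
      using fraction[of x d L "Suc k"] d L by auto
    define x' where "x' = real c / real p"
    have split: "norm (weyl_sum b h x' (L b + J))
        \<le> norm (weyl_sum b h x' (L b)) + (\<epsilon> (Suc k) * real J + T (Suc k))"
      if "b \<in> B" "h \<in> {1..Suc k}" for b h J
      unfolding weyl_sum_split using tail that
      by (intro norm_triangle_le add_left_mono) (auto simp: x'_def)
    \<comment> \<open>Up to \<open>L b\<close> the sum is compared with that of \<open>x\<close>;
      the remainder is the tail estimate of the new fraction. All additive constants together fit
      into the second \<open>\<epsilon> k * real J\<close>.\<close>
    have Qbound: "norm (weyl_sum b h x' J) \<le> 2 * \<epsilon> k * real J"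
      if bh: "b \<in> B" "h \<in> {1..k}" and J: "real b ^ J * d \<ge> 1" for b h J
    proof -
      have "L b \<le> J" unfolding L_def using J by (rule Least_le)
      then obtain J' where J': "J = L b + J'" using le_Suc_ex by blast
      have "norm (weyl_sum b h x' (L b) - weyl_sum b h x (L b))
          \<le> 2 * pi * real h * (real b ^ L b * \<bar>x' - x\<bar>)"
        using B(2) bh by (intro weyl_sum_close) auto
      also have "\<dots> \<le> 2 * pi * real h * (real b ^ L b * d)"
        using c by (intro mult_left_mono) (auto simp: x'_def)
      also have "\<dots> \<le> 2 * pi * real h * real b"
        using L bh by (intro mult_left_mono) auto
      finally have "norm (weyl_sum b h x' (L b)) \<le> norm (weyl_sum b h x (L b)) + 2 * pi * real h * real b"
        using norm_triangle_ineq2[of "weyl_sum b h x' (L b)" "weyl_sum b h x (L b)"] by linarith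
      also have "\<dots> \<le> \<epsilon> k * real (L b) + K + 2 * pi * real h * real b"
        using K bh by auto
      finally have "norm (weyl_sum b h x' (L b)) \<le> \<epsilon> k * real (L b) + K + 2 * pi * real h * real b" .
      moreover have "norm (weyl_sum b h x' J)
          \<le> norm (weyl_sum b h x' (L b)) + (\<epsilon> (Suc k) * real J' + T (Suc k))"
        unfolding J' using bh by (intro split) auto
      moreover have "\<epsilon> (Suc k) * real J' \<le> \<epsilon> k * real J'"
        using \<epsilon> by (intro mult_right_mono) auto
      moreover have "\<epsilon> k * real J = \<epsilon> k * real (L b) + \<epsilon> k * real J'"
        by (simp add: J' distrib_left)
      ultimately show ?thesis using gap[OF bh J] by linarith
    qed
    \<comment> \<open>For the new frequency \<open>Suc k\<close> nothing is known about
      \<open>x\<close>, so the initial segment is bounded trivially by its length. \<open>K'\<close>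
      may be large, since the next gap is chosen after it.\<close>
    define K' where "K' = real (\<Sum>b\<in>B. L b) + T (Suc k)"
    have "norm (weyl_sum b h x' J) \<le> \<epsilon> (Suc k) * real J + K'"
      if bh: "b \<in> B" "h \<in> {1..Suc k}" for b h J
    proof -
      have "L b \<le> (\<Sum>b\<in>B. L b)" using B(1) bh by (intro member_le_sum) auto
      then have LK: "real (L b) + T (Suc k) \<le> K'" by (simp add: K'_def del: of_nat_sum)
      show ?thesis
      proof (cases "J \<le> L b")
        case True
        have "norm (weyl_sum b h x' J) \<le> real (L b)" using norm_weyl_sum_le True
          by (meson of_nat_mono order_trans)
        moreover have "0 \<le> \<epsilon> (Suc k) * real J" using \<epsilon>(1)[of "Suc k"] by simp
        ultimately show ?thesis using LK T[of "Suc k"] by linarith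
      next
        case False
        define J' where "J' = J - L b"
        have J': "J = L b + J'" using False by (simp add: J'_def)
        have "norm (weyl_sum b h x' J) \<le> real (L b) + (\<epsilon> (Suc k) * real J' + T (Suc k))"
          unfolding J' using split[OF bh] norm_weyl_sum_le[of b h x' "L b"] by (smt (verit))
        moreover have "\<epsilon> (Suc k) * real J' \<le> \<epsilon> (Suc k) * real J"
          using \<epsilon>(1)[of "Suc k"] J' by (intro mult_left_mono) auto
        ultimately show ?thesis using LK by linarith
      qed
    qed
    then obtain d' where d': "R (Suc k) (x', d')" "x' + d' < x + d"
      using choose_gap[of x' "x + d" p c "Suc k" K'] c d p by (auto simp: x'_def)
    have "Q k y (x', d')" unfolding Q_def y using d' c Qbound by (auto simp: x'_def)
    then show ?thesis using d' by blast
  qed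
  obtain f where f: "\<And>k. R k (f k)" "\<And>k. Q k (f k) (f (Suc k))"
    using dependent_nat_choice[of R Q, OF base step] by blast
  define x where "x = (\<lambda>k. fst (f k))"
  define d where "d = (\<lambda>k. snd (f k))"
  have f_eq: "f k = (x k, d k)" for k by (simp add: x_def d_def)
  have dpos: "d k > 0" "0 < x k" "x k + d k < 1"
    and frac: "\<exists>p c :: nat. p > 1 \<and> x k = real c / real p \<and> d k < 1 / real p ^ k" for k
    using f(1)[of k] unfolding R_def f_eq by auto
  have incr: "x k < x (Suc k)" "x (Suc k) + d (Suc k) < x k + d k"
    and sums: "\<And>b h J. b \<in> B \<Longrightarrow> h \<in> {1..k} \<Longrightarrow> real b ^ J * d k \<ge> 1 \<Longrightarrow>
      norm (weyl_sum b h (x (Suc k)) J) \<le> 2 * \<epsilon> k * real J" for k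
    using f(2)[of k] unfolding Q_def f_eq by auto
  have d0: "d \<longlonglongrightarrow> 0"
  proof (rule tendsto_sandwich)
    show "\<forall>\<^sub>F k in sequentially. 0 \<le> d k" using dpos(1) by (simp add: less_imp_le)
    have "d k \<le> (1 / 2) ^ k" for k
    proof -
      obtain p :: nat where p: "p > 1" "d k < 1 / real p ^ k" using frac by blast
      then have "1 / real p ^ k \<le> 1 / 2 ^ k" by (intro divide_left_mono power_mono) auto
      then show ?thesis using p by (simp add: power_one_over)
    qed
    then show "\<forall>\<^sub>F k in sequentially. d k \<le> (1 / 2) ^ k" by simp
    show "(\<lambda>k. (1 / 2 :: real) ^ k) \<longlonglongrightarrow> 0" by (intro LIMSEQ_power_zero) simp
  qed auto
  obtain \<alpha> where \<alpha>: "\<And>k. x k \<le> \<alpha>" "\<And>k. \<alpha> \<le> x k + d k"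
  proof -
    have "(\<lambda>k. x k - (x k + d k)) \<longlonglongrightarrow> 0"
      using tendsto_minus[OF d0] by simp
    then show ?thesis
      using nested_sequence_unique[of x "\<lambda>k. x k + d k"] incr dpos(1) that
      by (auto simp: less_imp_le)
  qed
  \<comment> \<open>The left ends increase and the right ends decrease strictly, so
    \<open>\<alpha>\<close> differs from every \<open>x k\<close>, as the Liouville property
    requires.\<close>
  have \<alpha>_in: "x k < \<alpha>" "\<alpha> < x k + d k" for k
    using incr[of k] \<alpha>[of "Suc k"] by linarith+
  have \<alpha>01: "0 \<le> \<alpha>" "\<alpha> < 1" using \<alpha>_in[of 0] dpos[of 0] by linarith+
  have "liouville_number \<alpha>"
    unfolding liouville_number_def
  proof (intro conjI allI impI)
    show "\<alpha> \<in> {0..1}" using \<alpha>01 by simp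
    fix N :: nat assume "N > 0"
    obtain p c :: nat where p: "p > 1" "x N = real c / real p" "d N < 1 / real p ^ N"
      using frac by blast
    have "c > 0" using dpos(2)[of N] p by (cases c) auto
    then show "\<exists>p q :: int. p > 0 \<and> q > 1 \<and> 0 < \<bar>\<alpha> - of_int p / of_int q\<bar> \<and>
        \<bar>\<alpha> - of_int p / of_int q\<bar> < 1 / of_int q ^ N"
      using p \<alpha>_in[of N] by (intro exI[of _ "int c"] exI[of _ "int p"]) auto
  qed
  moreover have "normal_to_base b \<alpha>" if b: "b \<in> B" for b
  proof (rule normal_to_base_weyl[OF B(2)[OF b] \<alpha>01])
    fix h :: nat assume h: "h \<ge> 1"
    have b2: "real b \<ge> 2" using B(2)[OF b] by simp
    have bound: "norm (weyl_sum b h \<alpha> J) \<le> 2 * \<epsilon> m * real J + 2 * pi * real h"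
      if m: "m \<ge> h" "real b ^ J * d m \<ge> 1" for m J
    proof -
      have "(\<lambda>k. real b ^ J * d k) \<longlonglongrightarrow> real b ^ J * 0" by (intro tendsto_mult_left d0)
      then have "\<forall>\<^sub>F k in sequentially. real b ^ J * d k < 1"
        by (rule order_tendstoD) simp
      then have "\<forall>\<^sub>F k in sequentially. k \<ge> m \<and> real b ^ J * d k < 1"
        using eventually_ge_at_top by (rule eventually_elim2) auto
      then have ex: "\<exists>k. k \<ge> m \<and> real b ^ J * d k < 1"
        by (rule eventually_happens'[rotated]) simp
      \<comment> \<open>At the first stage whose gap is invisible at length \<open>J\<close>, the
        preceding gap is still visible. So the bound in \<open>Q\<close> applies to
        \<open>x k\<close>, and passing from \<open>x k\<close> to \<open>\<alpha>\<close> costs at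
        most \<open>2 * pi * real h\<close>.\<close>
      define k where "k = (LEAST k. k \<ge> m \<and> real b ^ J * d k < 1)"
      have k: "k \<ge> m" "real b ^ J * d k < 1"
        unfolding k_def using LeastI_ex[OF ex] by auto
      have "k \<noteq> m" using k(2) m(2) by auto
      define l where "l = k - 1"
      have l: "k = Suc l" "l \<ge> m" using k(1) \<open>k \<noteq> m\<close> by (auto simp: l_def)
      have "\<not> real b ^ J * d l < 1"
        using not_less_Least[of l "\<lambda>k. k \<ge> m \<and> real b ^ J * d k < 1"] l unfolding k_def by simp
      then have "norm (weyl_sum b h (x k) J) \<le> 2 * \<epsilon> l * real J"
        using sums[of b h l J] b h m l by simp
      also have "\<dots> \<le> 2 * \<epsilon> m * real J"
        using l by (intro mult_right_mono) (auto simp: \<epsilon>_def field_simps)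
      finally have 1: "norm (weyl_sum b h (x k) J) \<le> 2 * \<epsilon> m * real J" .
      have "norm (weyl_sum b h \<alpha> J - weyl_sum b h (x k) J) \<le> 2 * pi * real h * (real b ^ J * \<bar>\<alpha> - x k\<bar>)"
        using B(2)[OF b] by (rule weyl_sum_close)
      also have "\<dots> \<le> 2 * pi * real h * (real b ^ J * d k)"
        using \<alpha>_in[of k] by (intro mult_left_mono) auto
      also have "\<dots> \<le> 2 * pi * real h * 1"
        using k by (intro mult_left_mono) auto
      finally show ?thesis
        using 1 norm_triangle_ineq2[of "weyl_sum b h \<alpha> J" "weyl_sum b h (x k) J"] by linarith
    qed
    have "(\<lambda>J. weyl_sum b h \<alpha> J / of_nat J) \<longlonglongrightarrow> 0"
    proof (rule LIMSEQ_I)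
      fix r :: real assume r: "r > 0"
      obtain m where m: "m \<ge> h" "2 * \<epsilon> m < r / 2"
      proof -
        define m where "m = max h (nat \<lceil>4 / r\<rceil>)"
        have "4 / r < real (Suc m)" unfolding m_def by linarith
        then have "2 * \<epsilon> m < r / 2" using r by (simp add: \<epsilon>_def field_simps)
        then show ?thesis using that[of m] by (simp add: m_def)
      qed
      obtain J1 where J1: "1 / d m < real b ^ J1" using real_arch_pow[of "real b" "1 / d m"] b2 by auto
      \<comment> \<open>\<open>J1\<close> makes the gap \<open>d m\<close> visible, and the last
        entry makes \<open>2 * pi * real h\<close> at most \<open>r / 2 * real J\<close>.\<close>
      define J0 where "J0 = max (max J1 1) (nat \<lceil>4 * pi * real h / r\<rceil>)"
      have "norm (weyl_sum b h \<alpha> J / of_nat J - 0) < r" if J: "J \<ge> J0" for J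
      proof -
        have J_pos: "real J > 0" and Jr: "4 * pi * real h / r \<le> real J"
          using J unfolding J0_def by linarith+
        have "real b ^ J1 \<le> real b ^ J" using J b2 by (intro power_increasing) (auto simp: J0_def)
        then have "1 / d m < real b ^ J" using J1 by linarith
        then have "real b ^ J * d m \<ge> 1" using dpos(1)[of m] by (simp add: field_simps)
        then have "norm (weyl_sum b h \<alpha> J) \<le> 2 * \<epsilon> m * real J + 2 * pi * real h"
          by (rule bound[OF m(1)])
        also have "2 * pi * real h \<le> r / 2 * real J" using Jr r by (simp add: field_simps)
        also have "2 * \<epsilon> m * real J < r / 2 * real J"
          using m(2) J_pos by (rule mult_strict_right_mono)
        finally have "norm (weyl_sum b h \<alpha> J) < r * real J" by simp
        then show ?thesis using J_pos by (simp add: norm_divide pos_divide_less_eq)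
      qed
      then show "\<exists>no. \<forall>n\<ge>no. norm (weyl_sum b h \<alpha> n / of_nat n - 0) < r" by blast
    qed
    then show "(\<lambda>J. (\<Sum>j<J. ee (real h * (real b ^ j * \<alpha>))) / of_nat J) \<longlonglongrightarrow> 0"
      by (simp add: weyl_sum_def mult.assoc)
  qed
  ultimately show ?thesis by blast
qed

theorem mainTheorem5:
  fixes n :: nat and a :: "nat \<Rightarrow> nat"
  assumes "n \<ge> 2"
    and "1 < a 1"
    and "strict_mono_on {1..n} a"
    and "infinite {p::nat. prime p \<and> (\<forall>i\<in>{1..n}. residue_primroot p (a i))}"
  shows "\<exists>\<alpha>::real. liouville_number \<alpha> \<and> (\<forall>i\<in>{1..n}. normal_to_base (a i) \<alpha>)"
proof -
  have "a i \<ge> 2" if "i \<in> {1..n}" for i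
    using strict_mono_onD[OF assms(3), of 1 i] that assms(2) by (cases "i = 1") auto
  then have "\<exists>\<alpha>. liouville_number \<alpha> \<and> (\<forall>b\<in>a ` {1..n}. normal_to_base b \<alpha>)"
    by (intro exists_liouville_normal[OF _ _ assms(4)]) auto
  then show ?thesis by blast
qed

end
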